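(* Let $p$ be a prime with $p\equiv 1\pmod 3$. Then $$\sum_{k=0}^{p-1}(3k+2)\frac{D_k}{4^k}\equiv 2\sum_{k=0}^{p-1}(3k+1)\frac{D_k}{16^k}\equiv 2p^2\binom{\frac{p-1}{2}}{\frac{p-1}{6}}^{-2}\pmod{p^3}.$$
   Context: For $n\ge 0$ the $n$th Domb number is $D_n=\sum_{k=0}^n\binom{n}{k}^2\binom{2k}{k}\binom{2n-2k}{n-k}$. Congruences modulo $p^r$ between rational numbers mean that the difference lies in $p^r\mathbb{Z}_{p}$, where $\mathbb{Z}_p$ is the ring of $p$-adic integers. *)

theory Defs
  imports "HOL-Number_Theory.Number_Theory"
begin

definition Domb :: "nat \<Rightarrow> nat" where
  "Domb n = (\<Sum>k=0..n. (n choose k)\<^sup>2 * ((2 * k) choose k) * ((2 * n - 2 * k) choose (n - k)))"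

(* The set of p-integral rationals, i.e. the intersection of the rationals with the ring
   of p-adic integers (the localization of the integers at the prime p). *)
definition p_integral :: "nat \<Rightarrow> rat set" where
  "p_integral p = {of_int a / of_int b | a b :: int. \<not> int p dvd b}"

(* x - y lies in p^r Z_p.  As x, y and p^r are rational and p^r is nonzero, the p-adic cofactor
   (x - y) / p^r is itself rational, so it suffices to let z range over p_integral p. *)
definition rat_cong :: "nat \<Rightarrow> nat \<Rightarrow> rat \<Rightarrow> rat \<Rightarrow> bool" where
  "rat_cong p r x y \<longleftrightarrow> (\<exists>z \<in> p_integral p. x - y = of_nat p ^ r * z)"

end

theory Submission
  imports Defs
begin

text \<open>Write \<open>D n\<close> for the \<open>n\<close>-th Domb number. Since \<open>D n / n!\<^sup>2\<close> is the convolution square of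
  \<open>(2j choose j) / j!\<^sup>2\<close>, the Domb numbers satisfy a three-term recurrence (\<open>Domb_recurrence\<close>). The same
  recurrence is satisfied by \<open>4\<^sup>n\<close> times the sum over \<open>k\<close> of \<open>V n k\<close>, and by \<open>16\<^sup>n\<close> times the sum of
  \<open>V (- 1 - n) k\<close>, for one and the same family of polynomials in the first argument,
  \<open>V x k = c\<^sub>k (x + k) (x + k - 1) \<dots> (x - 2k + 1)\<close> with \<open>c\<^sub>k = (2k)! / (k!^5 16^k)\<close> (\<open>domb_poly\<close> below). So both
  expansions come from a single identity in \<open>x\<close>, the substitution \<open>x \<mapsto> - 1 - x\<close> exchanging them
  (\<open>Domb_eq_sum_domb_poly\<close>, \<open>Domb_eq_sum_domb_poly_neg\<close>).

  The weighted terms \<open>(3x + 2) V x k\<close> telescope in \<open>x\<close>. Summing over \<open>x = 0, \<dots>, p - 1\<close> or over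
  \<open>x = - p, \<dots>, - 1\<close> therefore gives, for \<open>q = p\<close> and for \<open>q = - p\<close> respectively, the exact formula
  \<open>q (3q + 1)\<close> times the sum over \<open>k < p\<close> of \<open>U q k / (3k + 2)\<close>, where
  \<open>q U q k = c\<^sub>k (q + k) \<dots> (q - 2k)\<close> (\<open>tele_poly\<close>, \<open>Domb_sum_4\<close>, \<open>Domb_sum_16\<close>). The two Domb sums are thus the
  values at \<open>p\<close> and \<open>- p\<close> of one expression.

  Let \<open>p = 6m + 1\<close>, let \<open>C = (3m choose m)\<close>, which is the binomial coefficient of the theorem, and let
  \<open>e = 1\<close> if \<open>q = p\<close> and \<open>e = - 5\<close> if \<open>q = - p\<close>. Because of the factor \<open>q\<close> in front, the sum over \<open>k\<close> matters
  only modulo \<open>p\<^sup>2\<close>. For \<open>k \<le> 3m\<close> its terms agree modulo \<open>p\<^sup>2\<close>, up to a common unit, with the coefficients of the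
  partial fraction decomposition of a quotient of two products of linear factors, so that the sum of the
  first \<open>3m + 1\<close> terms is congruent to a unit times the value of that quotient at \<open>2/3\<close>. One factor of the
  value is \<open>p e / 6\<close>, and Wilson's theorem evaluates the others modulo \<open>p\<close>; the result is \<open>2 p e / C\<^sup>2\<close>
  (\<open>tele_poly_cong\<close>, \<open>partial_fraction_linear_factors\<close>, \<open>head_sum_cong\<close>).

  For \<open>q = p\<close> all terms with \<open>k > 3m\<close> vanish, and the total is \<open>2 p\<^sup>2 / C\<^sup>2\<close> modulo \<open>p\<^sup>3\<close>. For \<open>q = - p\<close> the terms
  with \<open>k > 3m\<close> contribute \<open>0\<close> modulo \<open>p\<^sup>3\<close>, except for \<open>k = 4m\<close>, where \<open>3k + 2 = 2p\<close>. Evaluating that term requires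
  the relation between \<open>(2m)!\<close>, \<open>m!\<close> and \<open>(3m)!\<close> modulo \<open>p\<close> that comes from the duplication formula; it turns out
  to contribute \<open>- 9 p\<^sup>2 / C\<^sup>2\<close> (\<open>tail_sum_cong\<close>), which combines with \<open>10 p\<^sup>2 / C\<^sup>2\<close> from the first part to
  \<open>p\<^sup>2 / C\<^sup>2\<close>, half of the value for \<open>q = p\<close>.\<close>

section \<open>The Domb numbers as a self-convolution\<close>

text \<open>The coefficients of the square of the modified Bessel function \<open>I\<^sub>0 (2 sqrt x)\<close>; the generating function of
  \<open>D n / n!\<^sup>2\<close> is its fourth power.\<close>

definition bessel_coeff :: "nat \<Rightarrow> rat" where
  "bessel_coeff j = of_nat ((2 * j) choose j) / fact j ^ 2"

lemma bessel_coeff_Suc: "of_nat (Suc j) ^ 3 * bessel_coeff (Suc j) = 2 * of_nat (2 * j + 1) * bessel_coeff j"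
proof -
  have c: "of_nat ((2 * j) choose j) = (fact (2 * j) / (fact j * fact j) :: rat)" for j
    using binomial_fact[of j "2 * j"] by (simp add: mult_2)
  show ?thesis
    unfolding bessel_coeff_def c
    by (simp add: divide_simps) (simp add: algebra_simps power2_eq_square power3_eq_cube)
qed

text \<open>The weight \<open>g\<close> is a function of both indices because the recurrence is derived by moving powers of
  either index out of the weight.\<close>

definition bessel_conv :: "(rat \<Rightarrow> rat \<Rightarrow> rat) \<Rightarrow> nat \<Rightarrow> rat" where
  "bessel_conv g n = (\<Sum>k\<le>n. g (of_nat k) (of_nat (n - k)) * (bessel_coeff k * bessel_coeff (n - k)))"

lemma bessel_conv_swap: "bessel_conv g n = bessel_conv (\<lambda>a b. g b a) n"
  unfolding bessel_conv_def
  by (rule sum.reindex_bij_witness[of _ "\<lambda>j. n - j" "\<lambda>j. n - j"]) (auto simp: mult_ac)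

text \<open>A cube of one index lowers the total degree by one, by the first-order recurrence of the coefficients.\<close>

lemma bessel_conv_cube: "bessel_conv (\<lambda>a b. a ^ 3 * g a b) (Suc n) = bessel_conv (\<lambda>a b. 2 * (2 * a + 1) * g (a + 1) b) n"
proof -
  have "bessel_conv (\<lambda>a b. a ^ 3 * g a b) (Suc n)
      = (\<Sum>k\<le>n. g (of_nat (Suc k)) (of_nat (n - k)) * ((of_nat (Suc k) ^ 3 * bessel_coeff (Suc k)) * bessel_coeff (n - k)))"
    unfolding bessel_conv_def sum.atMost_Suc_shift[of _ n]
    by (simp add: mult_ac del: of_nat_Suc sum.atMost_Suc)
  also have "\<dots> = bessel_conv (\<lambda>a b. 2 * (2 * a + 1) * g (a + 1) b) n"
    unfolding bessel_coeff_Suc bessel_conv_def by (simp add: algebra_simps)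
  finally show ?thesis .
qed

lemma bessel_conv_cong:
  assumes "\<And>a b. a + b = of_nat n \<Longrightarrow> g a b = h a b"
  shows "bessel_conv g n = bessel_conv h n"
  unfolding bessel_conv_def by (rule sum.cong) (auto intro!: arg_cong2[where f="(*)"] assms simp: of_nat_diff)

lemma bessel_conv_add: "bessel_conv (\<lambda>a b. g a b + h a b) n = bessel_conv g n + bessel_conv h n"
  unfolding bessel_conv_def by (simp add: sum.distrib algebra_simps)

lemma bessel_conv_smult: "bessel_conv (\<lambda>a b. c * g a b) n = c * bessel_conv g n"
  unfolding bessel_conv_def by (simp add: sum_distrib_left algebra_simps)

text \<open>Weights matter only through their symmetrization. Identities between weights that fail as they stand
  become true after averaging over the exchange of the two indices.\<close>

lemma bessel_conv_symm: "bessel_conv g n = bessel_conv (\<lambda>a b. (g a b + g b a) / 2) n"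
proof -
  have "2 * bessel_conv g n = bessel_conv g n + bessel_conv (\<lambda>a b. g b a) n" using bessel_conv_swap[of g n] by simp
  also have "\<dots> = bessel_conv (\<lambda>a b. 2 * ((g a b + g b a) / 2)) n"
    unfolding bessel_conv_add[symmetric] by (rule bessel_conv_cong) simp
  also have "\<dots> = 2 * bessel_conv (\<lambda>a b. (g a b + g b a) / 2) n" by (rule bessel_conv_smult)
  finally show ?thesis by simp
qed

lemma Domb_bessel_conv: "of_nat (Domb n) = fact n ^ 2 * bessel_conv (\<lambda>_ _. 1) n"
  unfolding Domb_def bessel_conv_def sum_distrib_left of_nat_sum atLeast0AtMost
proof (rule sum.cong)
  fix k assume "k \<in> {..n}"
  then have k: "k \<le> n" by simp
  have "of_nat (n choose k) = (fact n / (fact k * fact (n - k)) :: rat)"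
    using k by (simp add: binomial_fact)
  then show "of_nat ((n choose k)\<^sup>2 * (2 * k choose k) * (2 * n - 2 * k choose (n - k)))
      = fact n ^ 2 * (1 * (bessel_coeff k * bessel_coeff (n - k)) :: rat)"
    by (simp add: bessel_coeff_def power_divide power_mult_distrib diff_mult_distrib2)
qed simp

text \<open>In degree \<open>N = n + 2\<close> the weight \<open>(a + b)^5\<close> is the constant \<open>N^5\<close>. Two applications of
  \<open>bessel_conv_cube\<close>, the first from degree \<open>n + 2\<close> to \<open>n + 1\<close> and the second from \<open>n + 1\<close> to \<open>n\<close>, reduce it to weights
  that depend only on \<open>a + b\<close>, which are constant in each degree.\<close>

lemma Domb_recurrence:
  "(of_nat n + 2) ^ 3 * of_nat (Domb (n + 2))
   = 2 * (2 * of_nat n + 3) * (5 * (of_nat n + 1)\<^sup>2 + 5 * (of_nat n + 1) + 2) * of_nat (Domb (n + 1))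
     - 64 * (of_nat n + 1) ^ 3 * (of_nat (Domb n) :: rat)"
proof -
  define x where "x = (of_nat n :: rat)"
  define C where "C = bessel_conv (\<lambda>_ _. 1)"
  have c: "bessel_conv (\<lambda>_ _. c) j = c * C j" for c j
    using bessel_conv_smult[of c "\<lambda>_ _. 1" j] unfolding C_def by simp
  have n2: "of_nat (n + 2) = x + 2" and n1: "of_nat (n + 1) = x + 1" by (simp_all add: x_def)
  have "(x + 2) ^ 5 * C (n + 2) = bessel_conv (\<lambda>a b. (a + b) ^ 5) (n + 2)"
    by (subst bessel_conv_cong[of "n + 2" "\<lambda>a b. (a + b) ^ 5" "\<lambda>_ _. (x + 2) ^ 5"]) (simp_all add: n2[symmetric] c)
  \<comment> \<open>Every monomial of degree five contains the cube of one of the two indices; by symmetry it suffices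
    to keep the three monomials with \<open>a\<^sup>3\<close>.\<close>
  also have "\<dots> = bessel_conv (\<lambda>a b. ((2 * (a ^ 3 * (a\<^sup>2 + 5 * a * b + 10 * b\<^sup>2)))
      + (2 * (b ^ 3 * (b\<^sup>2 + 5 * b * a + 10 * a\<^sup>2)))) / 2) (n + 2)"
    by (intro arg_cong2[where f = bessel_conv] ext) (simp_all add: algebra_simps eval_nat_numeral)
  also have "\<dots> = bessel_conv (\<lambda>a b. 2 * (a ^ 3 * (a\<^sup>2 + 5 * a * b + 10 * b\<^sup>2))) (n + 2)"
    using bessel_conv_symm[of "\<lambda>a b. 2 * (a ^ 3 * (a\<^sup>2 + 5 * a * b + 10 * b\<^sup>2))" "n + 2"] by (simp only:)
  also have "\<dots> = 2 * bessel_conv (\<lambda>a b. a ^ 3 * (a\<^sup>2 + 5 * a * b + 10 * b\<^sup>2)) (Suc (n + 1))"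
    by (simp add: bessel_conv_smult)
  also have "\<dots> = bessel_conv (\<lambda>a b. 2 * (2 * (2 * a + 1) * ((a + 1)\<^sup>2 + 5 * (a + 1) * b + 10 * b\<^sup>2))) (n + 1)"
    unfolding bessel_conv_cube bessel_conv_smult by simp
  \<comment> \<open>After symmetrization the coefficient of \<open>D (n + 1)\<close> in the recurrence accounts for everything except multiples of the
    pure cubes, to which the reduction applies again.\<close>
  also have "\<dots> = bessel_conv (\<lambda>a b. 2 * (2 * (x + 1) + 1) * (5 * (x + 1)\<^sup>2 + 5 * (x + 1) + 2)
      + (-16) * (a ^ 3 + b ^ 3)) (n + 1)"
    apply (subst bessel_conv_symm)
    apply (rule bessel_conv_cong)
    unfolding n1
    subgoal premises ab for a b
      unfolding ab[symmetric] by (simp add: field_simps eval_nat_numeral)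
    done
  also have "\<dots> = 2 * (2 * (x + 1) + 1) * (5 * (x + 1)\<^sup>2 + 5 * (x + 1) + 2) * C (n + 1)
      + (-16) * bessel_conv (\<lambda>a b. a ^ 3 + b ^ 3) (n + 1)"
    by (subst bessel_conv_add) (simp only: c bessel_conv_smult[of "-16"])
  also have "bessel_conv (\<lambda>a b. a ^ 3 + b ^ 3) (n + 1) = bessel_conv (\<lambda>a b. 4 * (x + 1)) n"
  proof -
    have "bessel_conv (\<lambda>a b. a ^ 3 + b ^ 3) (n + 1) = bessel_conv (\<lambda>a b. a ^ 3 * 2) (n + 1)"
      by (subst (2) bessel_conv_symm, rule bessel_conv_cong) (simp add: field_simps)
    also have "\<dots> = bessel_conv (\<lambda>a b. 2 * (2 * a + 1) * 2) n"
      using bessel_conv_cube[of "\<lambda>_ _. 2" n] by simp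
    also have "\<dots> = bessel_conv (\<lambda>a b. 4 * (x + 1)) n"
      apply (subst bessel_conv_symm)
      apply (rule bessel_conv_cong)
      by (simp add: x_def[symmetric] field_simps)
    finally show ?thesis .
  qed
  finally have main: "(x + 2) ^ 5 * C (n + 2)
      = 2 * (2 * (x + 1) + 1) * (5 * (x + 1)\<^sup>2 + 5 * (x + 1) + 2) * C (n + 1) - 64 * (x + 1) * C n"
    by (simp add: c)
  have f1: "fact (n + 1) = (x + 1) * (fact n :: rat)" by (simp add: x_def)
  have f2: "fact (n + 2) = (x + 2) * ((x + 1) * (fact n :: rat))" by (simp add: x_def algebra_simps)
  have "(x + 2) ^ 3 * of_nat (Domb (n + 2)) = (x + 1)\<^sup>2 * fact n ^ 2 * ((x + 2) ^ 5 * C (n + 2))"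
    unfolding Domb_bessel_conv f2 C_def by (simp add: eval_nat_numeral algebra_simps)
  also have "\<dots> = 2 * (2 * x + 3) * (5 * (x + 1)\<^sup>2 + 5 * (x + 1) + 2) * ((x + 1)\<^sup>2 * fact n ^ 2 * C (n + 1))
      - 64 * (x + 1) ^ 3 * (fact n ^ 2 * C n)"
    unfolding main by (simp add: eval_nat_numeral algebra_simps)
  also have "(x + 1)\<^sup>2 * fact n ^ 2 * C (n + 1) = of_nat (Domb (n + 1))"
    unfolding Domb_bessel_conv f1 C_def by (simp add: power_mult_distrib)
  also have "fact n ^ 2 * C n = of_nat (Domb n)"
    unfolding Domb_bessel_conv C_def by simp
  finally show ?thesis unfolding x_def .
qed

section \<open>Two polynomial families interpolating the Domb numbers\<close>

definition step_coeff :: "nat \<Rightarrow> rat" where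
  "step_coeff k = (2 * of_nat k + 1) / (8 * (of_nat k + 1) ^ 4)"

text \<open>The product \<open>(2k)! / (k!^5 16^k) (x + k) (x + k - 1) \<dots> (x - 2k + 1)\<close> of \<open>3k\<close> linear factors. The step from \<open>k\<close>
  to \<open>k + 1\<close> adds one factor at the upper and two at the lower end.\<close>

primrec domb_poly :: "rat \<Rightarrow> nat \<Rightarrow> rat" where
  "domb_poly x 0 = 1"
| "domb_poly x (Suc k) = domb_poly x k * (step_coeff k * (x + of_nat k + 1) * (x - 2 * of_nat k) * (x - 2 * of_nat k - 1))"

text \<open>The product \<open>(2k)! / (k!^5 16^k) (q + k) \<dots> (q - 2k)\<close> of \<open>3k + 1\<close> linear factors without the factor \<open>q\<close>. For
  \<open>q\<close> equal to \<open>p\<close> or \<open>- p\<close> this splits off the visible factor of \<open>p\<close>.\<close>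

primrec tele_poly :: "rat \<Rightarrow> nat \<Rightarrow> rat" where
  "tele_poly q 0 = 1"
| "tele_poly q (Suc k) = tele_poly q k * (step_coeff k * (q + of_nat k + 1) * (q - 2 * of_nat k - 1) * (q - 2 * of_nat k - 2))"

lemma domb_poly_tele_poly: "domb_poly x k * (x - 2 * of_nat k) = x * tele_poly x k"
proof (induction k)
  case (Suc k)
  have "domb_poly x (Suc k) * (x - 2 * of_nat (Suc k)) = (domb_poly x k * (x - 2 * of_nat k)) *
     (step_coeff k * (x + of_nat k + 1) * (x - 2 * of_nat k - 1) * (x - 2 * of_nat k - 2))"
    by (simp add: algebra_simps)
  then show ?case unfolding Suc by simp
qed simp

lemma domb_poly_plus_1_Suc:
  "domb_poly (x + 1) (Suc k) = domb_poly x k * (step_coeff k * (x + of_nat k + 1) * (x + of_nat k + 2) * (x - 2 * of_nat k))"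
proof (induction k)
  case (Suc k)
  have *: "domb_poly (x + 1) (Suc (Suc k)) = domb_poly (x + 1) (Suc k) *
      (step_coeff (Suc k) * (x + of_nat k + 3) * (x - 2 * of_nat k - 1) * (x - 2 * of_nat k - 2))"
    by (simp add: algebra_simps)
  show ?case unfolding * Suc by (simp add: algebra_simps)
qed (simp add: algebra_simps)

lemma domb_poly_minus_1_Suc:
  "domb_poly (x - 1) (Suc k) = domb_poly x k * (step_coeff k * (x - 2 * of_nat k) * (x - 2 * of_nat k - 1) * (x - 2 * of_nat k - 2))"
proof (induction k)
  case (Suc k)
  have *: "domb_poly (x - 1) (Suc (Suc k)) = domb_poly (x - 1) (Suc k) *
      (step_coeff (Suc k) * (x + of_nat k + 1) * (x - 2 * of_nat k - 3) * (x - 2 * of_nat k - 4))"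
    by (simp add: algebra_simps)
  show ?case unfolding * Suc by (simp add: algebra_simps)
qed (simp add: algebra_simps)

text \<open>The products for \<open>x - 1\<close> and \<open>x\<close> differ in one factor at each end. The recursion in \<open>k\<close> proves this also when
  \<open>x + k = 0\<close>, where one cannot divide.\<close>

lemma domb_poly_minus_1: "(x + of_nat k) * domb_poly (x - 1) k = (x - 2 * of_nat k) * domb_poly x k"
proof (cases k)
  case (Suc j)
  show ?thesis unfolding Suc domb_poly_minus_1_Suc by (simp add: algebra_simps)
qed simp

text \<open>Creative telescoping: the three-term operator maps each summand to a difference in \<open>k\<close>. The right-hand
  side vanishes for large \<open>K\<close> when \<open>x\<close> is an integer, so the full sum satisfies the homogeneous recurrence. As an
  identity in \<open>x\<close> it serves \<open>x = n + 1\<close> as well as \<open>x = - 2 - n\<close>.\<close>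

lemma domb_poly_recurrence_partial_sum:
  "(\<Sum>k\<le>K. 4 * (x + 1) ^ 3 * domb_poly (x + 1) k - 2 * (2 * x + 1) * (5 * x\<^sup>2 + 5 * x + 2) * domb_poly x k
      + 16 * x ^ 3 * domb_poly (x - 1) k)
   = - 6 * (2 * of_nat K + 1) * (3 * x + 1) * (x * tele_poly x K)"
proof (induction K)
  case 0
  then show ?case by (simp add: algebra_simps eval_nat_numeral)
next
  case (Suc K)
  define y where "y = (of_nat K :: rat)"
  have y: "y + 1 \<noteq> 0" unfolding y_def by (metis of_nat_Suc of_nat_neq_0 add.commute)
  have id: "- 6 * (2 * y + 1) * (3 * x + 1) * (domb_poly x K * (x - 2 * y)) +
     (4 * (x + 1) ^ 3 * (domb_poly x K * (step_coeff K * (x + y + 1) * (x + y + 2) * (x - 2 * y)))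
      - 2 * (2 * x + 1) * (5 * x\<^sup>2 + 5 * x + 2) * (domb_poly x K * (step_coeff K * (x + y + 1) * (x - 2 * y) * (x - 2 * y - 1)))
      + 16 * x ^ 3 * (domb_poly x K * (step_coeff K * (x - 2 * y) * (x - 2 * y - 1) * (x - 2 * y - 2))))
     = - 6 * (2 * y + 3) * (3 * x + 1) * (domb_poly x K * (step_coeff K * (x + y + 1) * (x - 2 * y) * (x - 2 * y - 1)) * (x - 2 * y - 2))"
    (is "?l = ?r")
  proof -
    have "- 6 * (2 * y + 1) * (3 * x + 1) +
     ((2 * y + 1) / (8 * (y + 1) ^ 4)) * (4 * (x + 1) ^ 3 * ((x + y + 1) * (x + y + 2))
      - 2 * (2 * x + 1) * (5 * x\<^sup>2 + 5 * x + 2) * ((x + y + 1) * (x - 2 * y - 1))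
      + 16 * x ^ 3 * ((x - 2 * y - 1) * (x - 2 * y - 2)))
     = - 6 * (2 * y + 3) * (3 * x + 1) * (((2 * y + 1) / (8 * (y + 1) ^ 4)) * (x + y + 1) * (x - 2 * y - 1) * (x - 2 * y - 2))"
      (is "?l' = ?r'")
      using y by (simp add: divide_simps) (simp add: algebra_simps eval_nat_numeral)
    then have "domb_poly x K * (x - 2 * y) * ?l' = domb_poly x K * (x - 2 * y) * ?r'" by simp
    then show ?thesis unfolding step_coeff_def y_def[symmetric] by (simp only: algebra_simps)
  qed
  have y1: "of_nat (Suc K) = y + 1" by (simp add: y_def)
  have "2 * (y + 1) + 1 = 2 * y + 3" "x - 2 * (y + 1) = x - 2 * y - 2" by simp_all
  then show ?case
    unfolding sum.atMost_Suc Suc domb_poly_plus_1_Suc domb_poly_minus_1_Suc domb_poly.simps(2)[of x] domb_poly_tele_poly[symmetric] y1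
      y_def[symmetric] by (simp only: id)
qed

lemma domb_poly_of_nat_eq_0: "n < 2 * k \<Longrightarrow> domb_poly (of_nat n) k = 0"
proof (induction k)
  case (Suc k)
  from Suc.prems have "n < 2 * k \<or> n = 2 * k \<or> n = 2 * k + 1" by auto
  then show ?case by (auto simp: Suc.IH)
qed simp

lemma domb_poly_neg_eq_0: "n < k \<Longrightarrow> domb_poly (- 1 - of_nat n) k = 0"
proof (induction k)
  case (Suc k)
  from Suc.prems have "n < k \<or> n = k" by auto
  then show ?case by (auto simp: Suc.IH)
qed simp

text \<open>The bound \<open>N\<close> allows the candidate sequence to be a sum truncated at \<open>N\<close>, which satisfies the recurrence only
  as long as the truncation loses no terms.\<close>

lemma Domb_unique:
  fixes a :: "nat \<Rightarrow> rat"
  assumes "a 0 = 1" and "N \<ge> 1 \<Longrightarrow> a 1 = 4"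
    and rec: "\<And>n. n + 2 \<le> N \<Longrightarrow> (of_nat n + 2) ^ 3 * a (n + 2)
        = 2 * (2 * of_nat n + 3) * (5 * (of_nat n + 1)\<^sup>2 + 5 * (of_nat n + 1) + 2) * a (n + 1)
          - 64 * (of_nat n + 1) ^ 3 * a n"
    and "n \<le> N"
  shows "a n = of_nat (Domb n)"
  using \<open>n \<le> N\<close>
proof (induction n rule: less_induct)
  case (less n)
  consider "n = 0" | "n = 1" | j where "n = j + 2"
    by (metis One_nat_def Suc_1 add.commute add_2_eq_Suc not0_implies_Suc)
  then show ?case
  proof cases
    case 1
    then show ?thesis using assms(1) by (simp add: Domb_def)
  next
    case 2
    then show ?thesis using assms(2) less.prems by (simp add: Domb_def)
  next
    case 3
    have "a (j + 1) = of_nat (Domb (j + 1))" "a j = of_nat (Domb j)"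
      using less.IH less.prems 3 by auto
    then have "(of_nat j + 2) ^ 3 * a (j + 2) = (of_nat j + 2) ^ 3 * of_nat (Domb (j + 2))"
      using rec[of j] Domb_recurrence[of j] less.prems 3 by simp
    moreover have "(of_nat j + 2 :: rat) \<noteq> 0"
      using of_nat_eq_0_iff[of "j + 2", where ?'a = rat] by simp
    ultimately show ?thesis unfolding 3 by simp
  qed
qed

lemma Domb_eq_sum_domb_poly:
  assumes "n \<le> N"
  shows "of_nat (Domb n) = 4 ^ n * (\<Sum>k\<le>N. domb_poly (of_nat n) k)"
proof (rule Domb_unique[symmetric, where a = "\<lambda>n. 4 ^ n * (\<Sum>k\<le>N. domb_poly (of_nat n) k)" and N = N])
  have V0: "(\<Sum>k\<le>N. domb_poly (of_nat n) k) = 1" if "n \<le> 1" for n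
  proof -
    have "domb_poly (of_nat n) k = (if k = 0 then 1 else 0)" for k
      using domb_poly_of_nat_eq_0[of n k] that by auto
    then show ?thesis by simp
  qed
  show "4 ^ 0 * (\<Sum>k\<le>N. domb_poly (of_nat 0) k) = 1" using V0[of 0] by simp
  show "4 ^ 1 * (\<Sum>k\<le>N. domb_poly (of_nat 1) k) = 4" using V0[of 1] by simp
next
  fix n assume n: "n + 2 \<le> N"
  define x where "x = (of_nat n + 1 :: rat)"
  define S where "S y = (\<Sum>k\<le>N. domb_poly y k)" for y
  have nx: "of_nat n = x - 1" "of_nat (n + 1) = x" "of_nat (n + 2) = x + 1" by (simp_all add: x_def)
  have "x * tele_poly x N = 0"
    unfolding domb_poly_tele_poly[symmetric] using domb_poly_of_nat_eq_0[of "n + 1" N] n unfolding nx by simp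
  then have "4 * (x + 1) ^ 3 * S (x + 1) - 2 * (2 * x + 1) * (5 * x\<^sup>2 + 5 * x + 2) * S x
      + 16 * x ^ 3 * S (x - 1) = 0"
    using domb_poly_recurrence_partial_sum[of x N]
    by (simp add: S_def sum.distrib sum_subtractf sum_distrib_left)
  then have "4 ^ n * 4 * (4 * (x + 1) ^ 3 * S (x + 1) - 2 * (2 * x + 1) * (5 * x\<^sup>2 + 5 * x + 2) * S x
      + 16 * x ^ 3 * S (x - 1)) = 0" by simp
  then show "(of_nat n + 2) ^ 3 * (4 ^ (n + 2) * (\<Sum>k\<le>N. domb_poly (of_nat (n + 2)) k))
      = 2 * (2 * of_nat n + 3) * (5 * (of_nat n + 1)\<^sup>2 + 5 * (of_nat n + 1) + 2)
          * (4 ^ (n + 1) * (\<Sum>k\<le>N. domb_poly (of_nat (n + 1)) k))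
        - 64 * (of_nat n + 1) ^ 3 * (4 ^ n * (\<Sum>k\<le>N. domb_poly (of_nat n) k))"
    unfolding nx S_def[symmetric] by (simp add: algebra_simps)
qed (fact assms)

text \<open>Under \<open>x = - 2 - n\<close> the recurrence in \<open>x\<close> runs backwards in \<open>n\<close>: the coefficients of \<open>V (x + 1)\<close> and \<open>V (x - 1)\<close>
  exchange their roles, which replaces the base \<open>4\<close> by \<open>16\<close>.\<close>

lemma Domb_eq_sum_domb_poly_neg:
  assumes "n \<le> N"
  shows "of_nat (Domb n) = 16 ^ n * (\<Sum>k\<le>N. domb_poly (- 1 - of_nat n) k)"
proof (rule Domb_unique[symmetric, where a = "\<lambda>n. 16 ^ n * (\<Sum>k\<le>N. domb_poly (- 1 - of_nat n) k)" and N = N])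
  have "domb_poly (- 1 - of_nat 0) k = (if k = 0 then 1 else 0)" for k
    using domb_poly_neg_eq_0[of 0 k] by auto
  then show "16 ^ 0 * (\<Sum>k\<le>N. domb_poly (- 1 - of_nat 0) k) = 1" by simp
next
  assume "1 \<le> N"
  have "domb_poly (- 1 - of_nat 1) k = (if k = 0 then 1 else 0) + (if k = 1 then - 3 / 4 else 0)" for k
  proof -
    consider "k = 0" | "k = Suc 0" | "k > 1" by linarith
    then show ?thesis using domb_poly_neg_eq_0[of 1 k] by cases (auto simp: step_coeff_def)
  qed
  then have "(\<Sum>k\<le>N. domb_poly (- 1 - of_nat 1) k) = 1 - 3 / 4"
    using \<open>1 \<le> N\<close> by (simp add: sum.distrib)
  then show "16 ^ 1 * (\<Sum>k\<le>N. domb_poly (- 1 - of_nat 1) k) = 4" by simp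
next
  fix n assume n: "n + 2 \<le> N"
  define x where "x = (- 2 - of_nat n :: rat)"
  define S where "S y = (\<Sum>k\<le>N. domb_poly y k)" for y
  have nx: "- 1 - of_nat n = x + 1" "- 1 - of_nat (n + 1) = x" "- 1 - of_nat (n + 2) = x - 1"
    "of_nat n = - 2 - x" by (simp_all add: x_def)
  have "x * tele_poly x N = 0"
    unfolding domb_poly_tele_poly[symmetric] using domb_poly_neg_eq_0[of "n + 1" N] n unfolding nx by simp
  then have "4 * (x + 1) ^ 3 * S (x + 1) - 2 * (2 * x + 1) * (5 * x\<^sup>2 + 5 * x + 2) * S x
      + 16 * x ^ 3 * S (x - 1) = 0"
    using domb_poly_recurrence_partial_sum[of x N]
    by (simp add: S_def sum.distrib sum_subtractf sum_distrib_left)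
  then have "16 ^ n * 16 * (4 * (x + 1) ^ 3 * S (x + 1) - 2 * (2 * x + 1) * (5 * x\<^sup>2 + 5 * x + 2) * S x
      + 16 * x ^ 3 * S (x - 1)) = 0" by simp
  then show "(of_nat n + 2) ^ 3 * (16 ^ (n + 2) * (\<Sum>k\<le>N. domb_poly (- 1 - of_nat (n + 2)) k))
      = 2 * (2 * of_nat n + 3) * (5 * (of_nat n + 1)\<^sup>2 + 5 * (of_nat n + 1) + 2)
          * (16 ^ (n + 1) * (\<Sum>k\<le>N. domb_poly (- 1 - of_nat (n + 1)) k))
        - 64 * (of_nat n + 1) ^ 3 * (16 ^ n * (\<Sum>k\<le>N. domb_poly (- 1 - of_nat n) k))"
    unfolding nx S_def[symmetric] by (simp add: algebra_simps eval_nat_numeral)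
qed (fact assms)

text \<open>Both products on the right contain \<open>V x k\<close>, with the complementary factors \<open>x + 1 + k\<close> and \<open>x - 2k\<close>; the
  weights \<open>3x + 4\<close> and \<open>3x + 1\<close> make the difference of the cofactors split as \<open>(3k + 2) (3x + 2)\<close>.\<close>

lemma domb_poly_weighted_telescope:
  "(3 * of_nat k + 2) * ((3 * x + 2) * domb_poly x k)
   = (3 * (x + 1) + 1) * ((x + 1) * tele_poly (x + 1) k) - (3 * x + 1) * (x * tele_poly x k)"
proof -
  have 1: "(x + 1) * tele_poly (x + 1) k = (x + 1 + of_nat k) * domb_poly x k"
    using domb_poly_minus_1[of "x + 1" k] domb_poly_tele_poly[of "x + 1" k] by (simp add: mult.commute)
  show ?thesis unfolding 1 unfolding domb_poly_tele_poly[symmetric] by (simp add: algebra_simps)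
qed

lemma three_k_2_neq_0: "(3 * of_nat k + 2 :: rat) \<noteq> 0"
  using of_nat_eq_0_iff[of "3 * k + 2", where ?'a = rat] by simp

lemma sum_domb_poly_weighted:
  "(\<Sum>n<p. (3 * of_nat n + 2) * domb_poly (of_nat n) k)
   = of_nat p * (3 * of_nat p + 1) * tele_poly (of_nat p) k / (3 * of_nat k + 2)"
proof -
  have "(3 * of_nat k + 2) * (\<Sum>n<p. (3 * of_nat n + 2) * domb_poly (of_nat n) k)
      = (3 * of_nat p + 1) * (of_nat p * tele_poly (of_nat p) k)"
  proof (induction p)
    case (Suc p)
    then show ?case using domb_poly_weighted_telescope[of k "of_nat p"]
      by (simp add: distrib_left add.commute)
  qed simp
  then show ?thesis using three_k_2_neq_0[of k] by (simp add: field_simps)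
qed

text \<open>The telescoping sum over \<open>x = - p, \<dots>, - 1\<close>; the weight \<open>3x + 2\<close> at \<open>x = - 1 - n\<close> is \<open>- (3n + 1)\<close>.\<close>

lemma sum_domb_poly_neg_weighted:
  "(\<Sum>n<p. (3 * of_nat n + 1) * domb_poly (- 1 - of_nat n) k)
   = - of_nat p * (1 - 3 * of_nat p) * tele_poly (- of_nat p) k / (3 * of_nat k + 2)"
proof -
  have "(3 * of_nat k + 2) * (\<Sum>n<p. (3 * of_nat n + 1) * domb_poly (- 1 - of_nat n) k)
      = (1 - 3 * of_nat p) * (- of_nat p * tele_poly (- of_nat p) k)"
  proof (induction p)
    case (Suc p)
    define x where "x = (- 1 - of_nat p :: rat)"
    have px: "- of_nat p = x + 1" "- of_nat (Suc p) = x" "1 - 3 * of_nat p = 3 * (x + 1) + 1"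
      "1 - 3 * of_nat (Suc p) = 3 * x + 1" "3 * of_nat p + 1 = - (3 * x + 2)" by (auto simp: x_def algebra_simps)
    have "a + b * - c * d = f" if "a = e" "b * (c * d) = e - f" for a b c d e f :: rat
      using that by simp
    from this[OF Suc[unfolded px] domb_poly_weighted_telescope[of k x]]
    show ?case
      unfolding sum.lessThan_Suc distrib_left x_def[symmetric] px
      by (simp only: mult.assoc)
  qed simp
  then show ?thesis using three_k_2_neq_0[of k]
    by (simp only: nonzero_eq_divide_eq mult_ac mult_minus_left mult_minus_right not_False_eq_True)
qed

lemma Domb_sum_4:
  assumes "p > 0"
  shows "(\<Sum>n=0..p-1. (3 * of_nat n + 2) * (of_nat (Domb n) / 4 ^ n))
    = of_nat p * (3 * of_nat p + 1) * (\<Sum>k\<le>p-1. tele_poly (of_nat p) k / (3 * of_nat k + 2))"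
proof -
  have ivl: "{0..p - 1} = {..<p}" using assms by auto
  have "(\<Sum>n=0..p-1. (3 * of_nat n + 2) * (of_nat (Domb n) / 4 ^ n))
      = (\<Sum>n<p. \<Sum>k\<le>p-1. (3 * of_nat n + 2) * domb_poly (of_nat n) k)"
    unfolding ivl sum_distrib_left[symmetric]
    by (intro sum.cong refl) (simp add: Domb_eq_sum_domb_poly[of _ "p - 1"])
  also have "\<dots> = (\<Sum>k\<le>p-1. \<Sum>n<p. (3 * of_nat n + 2) * domb_poly (of_nat n) k)" by (rule sum.swap)
  finally show ?thesis by (simp only: sum_domb_poly_weighted sum_distrib_left times_divide_eq_right)
qed

lemma Domb_sum_16:
  assumes "p > 0"
  shows "(\<Sum>n=0..p-1. (3 * of_nat n + 1) * (of_nat (Domb n) / 16 ^ n))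
    = - of_nat p * (1 - 3 * of_nat p) * (\<Sum>k\<le>p-1. tele_poly (- of_nat p) k / (3 * of_nat k + 2))"
proof -
  have ivl: "{0..p - 1} = {..<p}" using assms by auto
  have "(\<Sum>n=0..p-1. (3 * of_nat n + 1) * (of_nat (Domb n) / 16 ^ n))
      = (\<Sum>n<p. \<Sum>k\<le>p-1. (3 * of_nat n + 1) * domb_poly (- 1 - of_nat n) k)"
    unfolding ivl sum_distrib_left[symmetric]
    by (intro sum.cong refl) (simp add: Domb_eq_sum_domb_poly_neg[of _ "p - 1"])
  also have "\<dots> = (\<Sum>k\<le>p-1. \<Sum>n<p. (3 * of_nat n + 1) * domb_poly (- 1 - of_nat n) k)" by (rule sum.swap)
  finally show ?thesis by (simp only: sum_domb_poly_neg_weighted sum_distrib_left times_divide_eq_right)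
qed

section \<open>Partial fractions and finite products\<close>

text \<open>Induction on the number of factors. Multiplication by \<open>(x - r) / (x + n + 1)\<close> changes the residues at the old
  poles by the expected factor, and the new residue is the old decomposition evaluated at the new pole
  \<open>- (n + 1)\<close>, which the induction hypothesis computes in closed form.\<close>

lemma partial_fraction_linear_factors:
  fixes r :: "nat \<Rightarrow> 'a :: field_char_0"
  assumes "\<And>j. j \<le> n \<Longrightarrow> x + of_nat j \<noteq> 0"
  shows "(\<Sum>k\<le>n. (\<Prod>i<n. - of_nat k - r i) * (-1) ^ k / (fact k * fact (n - k)) / (x + of_nat k))
         = (\<Prod>i<n. x - r i) / (\<Prod>j\<le>n. x + of_nat j)"
  using assms
proof (induction n arbitrary: x)
  case 0
  then show ?case by simp
next
  case (Suc n)
  define c where "c k = (\<Prod>i<n. - of_nat k - r i) * (-1) ^ k / (fact k * fact (n - k) :: 'a)" for k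
  \<comment> \<open>the new pole\<close>
  define y :: 'a where "y = - of_nat (Suc n)"
  have nz: "x + of_nat j \<noteq> 0" if "j \<le> Suc n" for j using Suc.prems that by blast
  have IHx: "(\<Sum>k\<le>n. c k / (x + of_nat k)) = (\<Prod>i<n. x - r i) / (\<Prod>j\<le>n. x + of_nat j)"
    unfolding c_def using Suc.IH[of x] nz by (metis le_SucI)
  have ynz: "y + of_nat j \<noteq> 0" if "j \<le> n" for j
  proof
    assume "y + of_nat j = 0"
    then have "of_nat j = (of_nat (Suc n) :: 'a)" unfolding y_def by (simp add: algebra_simps)
    then show False using that by (metis Suc_n_not_le_n of_nat_eq_iff)
  qed
  have IHy: "(\<Sum>k\<le>n. c k / (y + of_nat k)) = (\<Prod>i<n. y - r i) / (\<Prod>j\<le>n. y + of_nat j)"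
    unfolding c_def using Suc.IH[of y] ynz by blast
  have py: "(\<Prod>j\<le>n. y + of_nat j) = (-1) ^ Suc n * fact (Suc n)"
  proof -
    have "(\<Prod>j\<le>n. y + of_nat j) = (\<Prod>j\<le>n. - of_nat (Suc (n - j)))"
      by (rule prod.cong) (auto simp: y_def of_nat_diff)
    also have "\<dots> = (\<Prod>j\<le>n. - of_nat (Suc j))"
      by (rule prod.reindex_bij_witness[of _ "\<lambda>j. n - j" "\<lambda>j. n - j"]) auto
    also have "\<dots> = (-1) ^ Suc n * fact (Suc n)"
    proof (induction n)
      case (Suc n)
      show ?case unfolding prod.atMost_Suc Suc fact_Suc[of "Suc n"] power_Suc[of _ "Suc n"]
        by (simp only: mult_minus_left mult_minus_right mult_1_left mult_ac of_nat_mult of_nat_fact)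
    qed simp
    finally show ?thesis .
  qed
  have split: "(x - r n) / ((x + of_nat k) * (x + of_nat (Suc n)))
      = (- of_nat k - r n) / of_nat (Suc n - k) / (x + of_nat k)
        - (of_nat (Suc n) + r n) / (x + of_nat (Suc n)) / (y + of_nat k)" if "k \<le> n" for k
  proof -
    define d where "d = (of_nat (Suc n - k) :: 'a)"
    have d0: "d \<noteq> 0" using that unfolding d_def of_nat_eq_0_iff by simp
    have sn: "of_nat (Suc n) = d + (of_nat k :: 'a)"
      unfolding d_def of_nat_add[symmetric] using that by simp
    have yk: "y + of_nat k = - d" unfolding y_def sn by simp
    have 1: "x + of_nat k \<noteq> 0" using nz that by auto
    have 2: "x + (d + of_nat k) \<noteq> 0" using nz[of "Suc n"] unfolding sn by simp
    show ?thesis unfolding yk sn d_def[symmetric] using d0 1 2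
      by (simp add: divide_simps) (simp add: algebra_simps)
  qed
  have new: "(\<Prod>i<Suc n. - of_nat k - r i) * (-1) ^ k / (fact k * fact (Suc n - k))
      = c k * (- of_nat k - r n) / of_nat (Suc n - k)" if "k \<le> n" for k
    unfolding c_def using that by (simp add: Suc_diff_le field_simps)
  have "(\<Prod>i<Suc n. x - r i) / (\<Prod>j\<le>Suc n. x + of_nat j)
      = (\<Sum>k\<le>n. c k / (x + of_nat k)) * (x - r n) / (x + of_nat (Suc n))"
    unfolding IHx by simp
  also have "\<dots> = (\<Sum>k\<le>n. c k * ((x - r n) / ((x + of_nat k) * (x + of_nat (Suc n)))))"
    by (simp add: sum_distrib_right sum_divide_distrib mult.assoc)
  also have "\<dots> = (\<Sum>k\<le>n. c k * (- of_nat k - r n) / of_nat (Suc n - k) / (x + of_nat k)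
        - (of_nat (Suc n) + r n) / (x + of_nat (Suc n)) * (c k / (y + of_nat k)))"
  proof (rule sum.cong)
    fix k assume "k \<in> {..n}"
    then have k: "k \<le> n" by simp
    show "c k * ((x - r n) / ((x + of_nat k) * (x + of_nat (Suc n))))
      = c k * (- of_nat k - r n) / of_nat (Suc n - k) / (x + of_nat k)
        - (of_nat (Suc n) + r n) / (x + of_nat (Suc n)) * (c k / (y + of_nat k))"
      unfolding split[OF k] by (simp only: right_diff_distrib times_divide_eq_right times_divide_eq_left
          divide_divide_eq_left mult_ac)
  qed simp
  also have "\<dots> = (\<Sum>k\<le>n. c k * (- of_nat k - r n) / of_nat (Suc n - k) / (x + of_nat k))
        - (of_nat (Suc n) + r n) / (x + of_nat (Suc n)) * ((\<Prod>i<n. y - r i) / (\<Prod>j\<le>n. y + of_nat j))"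
    by (simp only: sum_subtractf sum_distrib_left[symmetric] IHy)
  also have "(of_nat (Suc n) + r n) / (x + of_nat (Suc n)) * ((\<Prod>i<n. y - r i) / (\<Prod>j\<le>n. y + of_nat j))
      = - ((\<Prod>i<Suc n. y - r i) * (-1) ^ Suc n / fact (Suc n) / (x + of_nat (Suc n)))"
  proof -
    have sgn: "z / ((-1) ^ Suc n * fact (Suc n)) = z * (-1) ^ Suc n / fact (Suc n)" for z :: 'a
      by (cases "even n") auto
    have yr: "y - r n = - (of_nat (Suc n) + r n)" by (simp add: y_def)
    show ?thesis unfolding py sgn prod.lessThan_Suc yr
      by (simp only: mult_minus_left mult_minus_right minus_divide_left minus_minus times_divide_eq_right
          times_divide_eq_left divide_divide_eq_left mult_ac)
  qed
  also have "(\<Sum>k\<le>n. c k * (- of_nat k - r n) / of_nat (Suc n - k) / (x + of_nat k))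
      = (\<Sum>k\<le>n. (\<Prod>i<Suc n. - of_nat k - r i) * (-1) ^ k / (fact k * fact (Suc n - k)) / (x + of_nat k))"
    by (rule sum.cong) (simp_all only: new atMost_iff)
  finally show ?case
    unfolding sum.atMost_Suc y_def by (simp only: diff_self_eq_0 fact_0 mult_1_right diff_minus_eq_add)
qed

lemma prod_of_nat_plus_1: "(\<Prod>i<s. of_nat i + 1) = (fact s :: rat)"
  by (induction s) (auto simp: algebra_simps)

lemma prod_of_nat_minus:
  assumes "a \<le> b"
  shows "(\<Prod>i<a. of_nat i - of_nat b) = (-1) ^ a * (fact b / fact (b - a) :: rat)"
  using assms
proof (induction a)
  case (Suc a)
  have e: "b - a = Suc (b - Suc a)" using Suc.prems by simp
  have "of_nat a - of_nat b = - (of_nat (b - a) :: rat)" using Suc.prems by (simp add: of_nat_diff)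
  then have "(\<Prod>i<Suc a. of_nat i - of_nat b) = (-1) ^ a * (fact b / fact (b - a)) * - (of_nat (b - a) :: rat)"
    using Suc by simp
  also have "\<dots> = (-1) ^ Suc a * (fact b / fact (b - Suc a))"
    unfolding e by (simp add: divide_simps del: of_nat_Suc)
  finally show ?case .
qed simp

lemma fact_add: "fact (a + b) = (fact a * (\<Prod>i<b. of_nat a + 1 + of_nat i) :: rat)"
  by (induction b) (auto simp: algebra_simps)

lemma fact_double: "fact (2 * m) = (4 ^ m * fact m * (\<Prod>i<m. 1 / 2 + of_nat i) :: rat)"
proof (induction m)
  case (Suc m)
  have "fact (2 * Suc m) = (2 * of_nat m + 2) * (2 * of_nat m + 1) * (fact (2 * m) :: rat)"
    by (simp add: algebra_simps)
  then show ?case unfolding Suc by (simp add: field_simps)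
qed simp

lemma prod_shift_one:
  fixes f :: "nat \<Rightarrow> 'a :: comm_monoid_mult"
  shows "(\<Prod>i<l + 1 + s. f i) = (\<Prod>i<l. f i) * f l * (\<Prod>i<s. f (l + 1 + i))"
  by (induction s) (auto simp: ac_simps)

text \<open>The residue at \<open>- k\<close> in the partial fraction decomposition of
  \<open>(x + 1/2 - t) \<dots> (x + n - 1/2 - t) / (x (x + 1) \<dots> (x + n))\<close>. For \<open>t = 0\<close> this is
  \<open>(2k choose k) (2(n - k) choose (n - k)) / 4^n\<close>; the shift \<open>t\<close> is a free parameter that is chosen as a multiple of
  \<open>p\<close> to match first-order terms.\<close>

definition pf_coeff :: "rat \<Rightarrow> nat \<Rightarrow> nat \<Rightarrow> rat" where
  "pf_coeff t n k = (\<Prod>i<n. - of_nat k - (t - 1 / 2 - of_nat i)) * (-1) ^ k / (fact k * fact (n - k))"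

text \<open>The numerator products at \<open>- k\<close> and \<open>- k - 1\<close> run over the same progression shifted by one, so they differ only in
  their end factors.\<close>

lemma pf_coeff_Suc:
  assumes "k < n"
  shows "(of_nat k + 1) * (of_nat n - of_nat k - 1 / 2 - t) * pf_coeff t n (Suc k)
     = (of_nat k + 1 / 2 + t) * (of_nat n - of_nat k) * pf_coeff t n k"
proof -
  define g where "g i = of_nat i - of_nat k - 1 / 2 - t" for i
  have A: "(\<Prod>i<n. - of_nat k - (t - 1 / 2 - of_nat i)) = (\<Prod>i<n. g (Suc i))"
    by (rule prod.cong) (auto simp: g_def)
  have B: "(\<Prod>i<n. - of_nat (Suc k) - (t - 1 / 2 - of_nat i)) = (\<Prod>i<n. g i)"
    by (rule prod.cong) (auto simp: g_def)
  have sh: "(\<Prod>i<n. g i) * g n = g 0 * (\<Prod>i<n. g (Suc i))"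
    by (metis prod.lessThan_Suc prod.lessThan_Suc_shift)
  obtain j where j: "n - k = Suc j" "n - Suc k = j" using assms by (metis Suc_diff_Suc)
  have nk: "of_nat n - of_nat k = (of_nat j + 1 :: rat)"
    using j(1) assms by (metis of_nat_Suc of_nat_diff less_imp_le add.commute)
  define r where "r = ((-1) ^ k / (fact k * fact j) :: rat)"
  have j1: "(of_nat j + 1 :: rat) \<noteq> 0" "(of_nat k + 1 :: rat) \<noteq> 0"
    using of_nat_neq_0[of j, where ?'a = rat] of_nat_neq_0[of k, where ?'a = rat] by (simp_all add: add.commute)
  define kk where "kk = (of_nat k + 1 :: rat)"
  define jj where "jj = (of_nat j + 1 :: rat)"
  have fs: "fact (Suc k) = kk * (fact k :: rat)" "fact (Suc j) = jj * (fact j :: rat)"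
    by (simp_all add: kk_def jj_def add.commute)
  have 1: "(of_nat k + 1) * pf_coeff t n (Suc k) = - (\<Prod>i<n. g i) * r"
    using j1 unfolding pf_coeff_def B j r_def fs kk_def[symmetric] jj_def[symmetric] by (simp add: divide_simps)
  have 2: "(of_nat j + 1) * pf_coeff t n k = (\<Prod>i<n. g (Suc i)) * r"
    using j1 unfolding pf_coeff_def A j r_def fs kk_def[symmetric] jj_def[symmetric] by (simp add: divide_simps)
  have gn: "of_nat n - of_nat k - 1 / 2 - t = g n" "of_nat k + 1 / 2 + t = - g 0"
    by (simp_all add: g_def)
  have "(of_nat k + 1) * g n * pf_coeff t n (Suc k) = ((of_nat k + 1) * pf_coeff t n (Suc k)) * g n"
    by (simp only: mult_ac)
  also have "\<dots> = - ((\<Prod>i<n. g i) * g n) * r" unfolding 1 by (simp only: mult_ac mult_minus_left mult_minus_right)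
  also have "\<dots> = - g 0 * ((of_nat j + 1) * pf_coeff t n k)" unfolding sh 2 by (simp only: mult_ac mult_minus_left mult_minus_right)
  finally show ?thesis unfolding gn unfolding nk by (simp only: mult_ac)
qed

text \<open>The quotient of consecutive terms \<open>U q k\<close>, minus the quotient of consecutive residues for
  \<open>n = (P - 1) / 2\<close>, at \<open>K = k + 1\<close> and \<open>q = P\<close>, \<open>t = 0\<close>. The terms of order zero and one in \<open>P\<close> cancel.\<close>

lemma ratio_identity_pos:
  fixes K P :: rat
  assumes "K \<noteq> 0" "P - 2 * K \<noteq> 0"
  shows "(2 * K - 1) / (8 * K ^ 4) * (P + K) * (P - 2 * K + 1) * (P - 2 * K)
      - (2 * K - 1) * (P - 2 * K + 1) / (2 * K * (P - 2 * K))
    = P\<^sup>2 * ((2 * K - 1) * (P - 2 * K + 1) * (P - 3 * K) / (8 * K ^ 4 * (P - 2 * K)))"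
  using assms by (simp add: divide_simps) (simp add: algebra_simps eval_nat_numeral)

text \<open>The same difference at \<open>q = - P\<close>, where the first-order terms cancel for the shift \<open>t = P\<close>.\<close>

lemma ratio_identity_neg:
  fixes K P :: rat
  assumes "K \<noteq> 0" "- P - 2 * K \<noteq> 0"
  shows "(2 * K - 1) / (8 * K ^ 4) * (- P + K) * (- P - 2 * K + 1) * (- P - 2 * K)
      - (2 * K - 1 + 2 * P) * (P - 2 * K + 1) / (2 * K * (- P - 2 * K))
    = P\<^sup>2 * (((2 * K - 1) * (2 * K - 1 + P) * (3 * K + P) - 8 * K ^ 3) / (8 * K ^ 4 * (- P - 2 * K)))"
proof -
  have "2 * K + P \<noteq> 0" using assms(2) by auto
  then show ?thesis
  using assms by (simp add: divide_simps) (simp add: algebra_simps eval_nat_numeral)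
qed

text \<open>For \<open>q = - p\<close> the product of linear factors is, up to sign, the quotient of \<open>(p + 2k)!\<close> by \<open>(p - 1 - k)!\<close>. This form
  shows the powers of \<open>p\<close> in the terms with \<open>2k > p\<close>.\<close>

lemma tele_poly_neg_closed:
  assumes "k < p"
  shows "of_nat p * tele_poly (- of_nat p) k * (fact k ^ 5 * 16 ^ k * fact (p - 1 - k))
    = (-1) ^ k * fact (2 * k) * fact (p + 2 * k)"
  using assms
proof (induction k)
  case 0
  then show ?case using fact_reduce[of p, where ?'a = rat] by simp
next
  case (Suc k)
  define y where "y = (of_nat k :: rat)"
  have y1: "y + 1 \<noteq> 0" unfolding y_def using of_nat_neq_0[of k, where ?'a = rat] by (simp add: add.commute)
  have e: "p - 1 - k = Suc (p - 1 - Suc k)" using Suc.prems by simp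
  have c: "of_nat (Suc (p - 1 - Suc k)) = of_nat p - 1 - y"
    unfolding e[symmetric] y_def using Suc.prems by (simp add: of_nat_diff)
  define F where "F = (fact (p - 1 - Suc k) :: rat)"
  have f1: "fact (p - 1 - k) = (of_nat p - 1 - y) * F" unfolding e fact_Suc c F_def ..
  have f2: "fact (2 * Suc k) = (2 * y + 2) * (2 * y + 1) * (fact (2 * k) :: rat)"
    unfolding y_def by (simp add: algebra_simps)
  have f3: "fact (p + 2 * Suc k) = (of_nat p + 2 * y + 2) * (of_nat p + 2 * y + 1) * (fact (p + 2 * k) :: rat)"
    unfolding y_def by (simp add: algebra_simps)
  have f4: "fact (Suc k) = (y + 1) * (fact k :: rat)" unfolding y_def by simp
  have t: "step_coeff k * (y + 1) ^ 5 * 16 = (2 * y + 2) * (2 * y + 1)"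
    unfolding step_coeff_def y_def[symmetric] using y1 by (simp add: divide_simps) (simp add: algebra_simps eval_nat_numeral)
  have g: "- of_nat p + y + 1 = - (of_nat p - 1 - y)" "- of_nat p - 2 * y - 1 = - (of_nat p + 2 * y + 1)"
    "- of_nat p - 2 * y - 2 = - (of_nat p + 2 * y + 2)" by simp_all
  have "of_nat p * tele_poly (- of_nat p) (Suc k) * (fact (Suc k) ^ 5 * 16 ^ Suc k * F)
      = (step_coeff k * (y + 1) ^ 5 * 16) * (- 1) * (of_nat p + 2 * y + 1) * (of_nat p + 2 * y + 2)
        * (of_nat p * tele_poly (- of_nat p) k * (fact k ^ 5 * 16 ^ k * ((of_nat p - 1 - y) * F)))"
    unfolding f4 tele_poly.simps y_def[symmetric] g power_mult_distrib power_Suc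
    by (simp only: mult_ac mult_minus_left mult_minus_right minus_minus mult_1_left mult_1_right)
  also have "\<dots> = (-1) ^ Suc k * fact (2 * Suc k) * fact (p + 2 * Suc k)"
    unfolding t f2 f3 f1[symmetric] Suc.IH[OF Suc_lessD[OF Suc.prems]] power_Suc
    by (simp only: mult_ac mult_minus_left mult_minus_right mult_1_left mult_1_right)
  finally show ?case unfolding F_def .
qed

section \<open>Congruences between rational numbers\<close>

text \<open>The condition \<open>x \<noteq> 0\<close> is stated separately because \<open>inverse 0 = 0\<close> is \<open>p\<close>-integral.\<close>

definition p_unit :: "nat \<Rightarrow> rat \<Rightarrow> bool" where
  "p_unit p x \<longleftrightarrow> x \<noteq> 0 \<and> x \<in> p_integral p \<and> inverse x \<in> p_integral p"

context
  fixes p :: nat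
  assumes p: "prime p"
begin

lemma p_integral_of_int: "of_int a \<in> p_integral p"
proof -
  have "of_int a = (of_int a / of_int 1 :: rat)" "\<not> int p dvd 1"
    using p by (auto simp: prime_nat_iff)
  then show ?thesis unfolding p_integral_def by blast
qed

lemma p_integral_of_nat: "of_nat n \<in> p_integral p"
  using p_integral_of_int[of "int n"] by simp

lemma p_integral_numeral: "numeral n \<in> p_integral p"
  using p_integral_of_int[of "numeral n"] by simp

lemma p_integral_0: "0 \<in> p_integral p" and p_integral_1: "1 \<in> p_integral p"
  using p_integral_of_int[of 0] p_integral_of_int[of 1] by simp_all

lemma p_integral_fact: "fact n \<in> p_integral p"
  using p_integral_of_nat[of "fact n"] by simp

lemma not_dvd_mult: "\<not> int p dvd b \<Longrightarrow> \<not> int p dvd d \<Longrightarrow> \<not> int p dvd b * d"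
  using p prime_dvd_mult_iff[of "int p"] by auto

lemma p_integral_mult:
  assumes "x \<in> p_integral p" "y \<in> p_integral p" shows "x * y \<in> p_integral p"
proof -
  from assms obtain a b c d where "x = of_int a / of_int b" "y = of_int c / of_int d"
    "\<not> int p dvd b" "\<not> int p dvd d" unfolding p_integral_def by blast
  then have "x * y = of_int (a * c) / of_int (b * d)" "\<not> int p dvd b * d"
    using not_dvd_mult by auto
  then show ?thesis unfolding p_integral_def by blast
qed

lemma p_integral_add:
  assumes "x \<in> p_integral p" "y \<in> p_integral p" shows "x + y \<in> p_integral p"
proof -
  from assms obtain a b c d where *: "x = of_int a / of_int b" "y = of_int c / of_int d"
    "\<not> int p dvd b" "\<not> int p dvd d" unfolding p_integral_def by blast
  then have "b \<noteq> 0" "d \<noteq> 0" by auto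
  then have "x + y = of_int (a * d + c * b) / of_int (b * d)" unfolding * by (simp add: field_simps)
  then show ?thesis unfolding p_integral_def using not_dvd_mult[OF *(3,4)] by blast
qed

lemma p_integral_uminus: "x \<in> p_integral p \<Longrightarrow> - x \<in> p_integral p"
  using p_integral_mult[of "of_int (- 1)" x] p_integral_of_int[of "- 1"] by simp

lemma p_integral_diff: "x \<in> p_integral p \<Longrightarrow> y \<in> p_integral p \<Longrightarrow> x - y \<in> p_integral p"
  using p_integral_add[of x "- y"] p_integral_uminus by simp

lemma p_integral_power: "x \<in> p_integral p \<Longrightarrow> x ^ n \<in> p_integral p"
  by (induction n) (auto intro: p_integral_mult p_integral_1)

lemma p_integral_prod: "(\<And>i. i \<in> A \<Longrightarrow> f i \<in> p_integral p) \<Longrightarrow> prod f A \<in> p_integral p"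
  by (induction A rule: infinite_finite_induct) (auto intro: p_integral_mult p_integral_1)

lemma p_unit_integral: "p_unit p x \<Longrightarrow> x \<in> p_integral p"
  and p_unit_nonzero: "p_unit p x \<Longrightarrow> x \<noteq> 0"
  by (simp_all add: p_unit_def)

lemma p_integral_divide: "x \<in> p_integral p \<Longrightarrow> p_unit p u \<Longrightarrow> x / u \<in> p_integral p"
  unfolding p_unit_def divide_inverse by (blast intro: p_integral_mult)

lemmas p_integral_intros = p_integral_of_int p_integral_of_nat p_integral_numeral p_integral_0
  p_integral_1 p_integral_fact p_integral_mult p_integral_add p_integral_uminus p_integral_diff
  p_integral_power p_integral_prod p_integral_divide

lemma p_unit_of_int: assumes "\<not> int p dvd a" shows "p_unit p (of_int a)"
proof -
  have "inverse (of_int a) = (of_int 1 / of_int a :: rat)" by (simp add: divide_inverse)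
  then have "inverse (of_int a) \<in> p_integral p" unfolding p_integral_def using assms by blast
  then show ?thesis unfolding p_unit_def using assms p_integral_of_int by auto
qed

lemma p_unit_of_nat: "\<not> p dvd n \<Longrightarrow> p_unit p (of_nat n)"
  using p_unit_of_int[of "int n"] by simp

lemma p_unit_1: "p_unit p 1"
  unfolding p_unit_def by (simp add: p_integral_1)

lemma p_unit_mult: "p_unit p x \<Longrightarrow> p_unit p y \<Longrightarrow> p_unit p (x * y)"
  unfolding p_unit_def by (auto intro: p_integral_mult simp: mult.commute)

lemma p_unit_inverse: "p_unit p x \<Longrightarrow> p_unit p (inverse x)"
  unfolding p_unit_def by auto

lemma p_unit_divide: "p_unit p x \<Longrightarrow> p_unit p y \<Longrightarrow> p_unit p (x / y)"
  unfolding divide_inverse by (intro p_unit_mult p_unit_inverse)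

lemma p_unit_uminus: "p_unit p x \<Longrightarrow> p_unit p (- x)"
  unfolding p_unit_def by (auto intro: p_integral_uminus)

lemma p_unit_power: "p_unit p x \<Longrightarrow> p_unit p (x ^ n)"
  by (induction n) (auto intro: p_unit_mult p_unit_1)

lemma p_unit_fact: "n < p \<Longrightarrow> p_unit p (fact n)"
proof (induction n)
  case (Suc n)
  then have "\<not> p dvd Suc n" by (auto dest: dvd_imp_le)
  then show ?case using Suc p_unit_mult p_unit_of_nat[of "Suc n"] by simp
qed (simp add: p_unit_1)

lemmas p_unit_intros = p_unit_1 p_unit_mult p_unit_inverse p_unit_divide p_unit_uminus
  p_unit_power p_unit_fact

lemma rat_cong_refl: "rat_cong p r x x"
  unfolding rat_cong_def using p_integral_0 by force

lemma rat_cong_sym: "rat_cong p r x y \<Longrightarrow> rat_cong p r y x"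
proof -
  assume "rat_cong p r x y"
  then obtain z where "z \<in> p_integral p" "x - y = of_nat p ^ r * z" unfolding rat_cong_def by blast
  then have "- z \<in> p_integral p" "y - x = of_nat p ^ r * (- z)"
    by (auto intro: p_integral_uminus simp: algebra_simps)
  then show ?thesis unfolding rat_cong_def by blast
qed

lemma rat_cong_trans:
  assumes "rat_cong p r x y" "rat_cong p r y z" shows "rat_cong p r x z"
proof -
  from assms obtain a b where "a \<in> p_integral p" "b \<in> p_integral p"
    "x - y = of_nat p ^ r * a" "y - z = of_nat p ^ r * b" unfolding rat_cong_def by blast
  moreover from this have "x - z = of_nat p ^ r * (a + b)" by (simp add: algebra_simps)
  ultimately show ?thesis unfolding rat_cong_def using p_integral_add by blast
qed

lemma rat_cong_add:
  assumes "rat_cong p r x x'" "rat_cong p r y y'" shows "rat_cong p r (x + y) (x' + y')"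
proof -
  from assms obtain a b where "a \<in> p_integral p" "b \<in> p_integral p"
    "x - x' = of_nat p ^ r * a" "y - y' = of_nat p ^ r * b" unfolding rat_cong_def by blast
  moreover from this have "(x + y) - (x' + y') = of_nat p ^ r * (a + b)" by (simp add: algebra_simps)
  ultimately show ?thesis unfolding rat_cong_def using p_integral_add by blast
qed

lemma rat_cong_scale:
  assumes "rat_cong p r x y" "z \<in> p_integral p" shows "rat_cong p r (z * x) (z * y)"
proof -
  from assms obtain a where "a \<in> p_integral p" "x - y = of_nat p ^ r * a"
    unfolding rat_cong_def by blast
  moreover from this have "z * x - z * y = of_nat p ^ r * (z * a)" by (simp add: algebra_simps)
  ultimately show ?thesis unfolding rat_cong_def using p_integral_mult assms(2) by blast
qed

lemma rat_cong_sum: "(\<And>i. i \<in> A \<Longrightarrow> rat_cong p r (f i) (g i)) \<Longrightarrow> rat_cong p r (sum f A) (sum g A)"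
  by (induction A rule: infinite_finite_induct) (auto intro: rat_cong_refl rat_cong_add)

lemma rat_cong_mult:
  assumes "rat_cong p r x x'" "rat_cong p r y y'" "x \<in> p_integral p" "y' \<in> p_integral p"
  shows "rat_cong p r (x * y) (x' * y')"
  using rat_cong_trans[OF rat_cong_scale[OF assms(2,3)]] rat_cong_scale[OF assms(1,4)]
  by (simp add: mult.commute)

lemma rat_cong_prod:
  assumes "\<And>i. i \<in> A \<Longrightarrow> rat_cong p r (f i) (g i)" "\<And>i. i \<in> A \<Longrightarrow> f i \<in> p_integral p"
    "\<And>i. i \<in> A \<Longrightarrow> g i \<in> p_integral p"
  shows "rat_cong p r (prod f A) (prod g A)"
  using assms by (induction A rule: infinite_finite_induct)
    (auto intro!: rat_cong_refl rat_cong_mult p_integral_prod)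

lemma rat_cong_power:
  assumes "rat_cong p r x y" "x \<in> p_integral p" "y \<in> p_integral p"
  shows "rat_cong p r (x ^ n) (y ^ n)"
  by (induction n) (auto intro!: rat_cong_refl rat_cong_mult assms p_integral_power)

lemma rat_cong_p_mult:
  "rat_cong p r x y \<Longrightarrow> s + r = u \<Longrightarrow> rat_cong p u (of_nat p ^ s * x) (of_nat p ^ s * y)"
  unfolding rat_cong_def by (auto simp: power_add mult.assoc right_diff_distrib[symmetric])

lemma rat_cong_cancel: "p_unit p u \<Longrightarrow> rat_cong p r (u * x) (u * y) \<Longrightarrow> rat_cong p r x y"
  using rat_cong_scale[of r "u * x" "u * y" "inverse u"] unfolding p_unit_def
  by (simp add: mult.assoc[symmetric])

lemma p_integral_cong: "rat_cong p r x y \<Longrightarrow> y \<in> p_integral p \<Longrightarrow> x \<in> p_integral p"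
proof -
  assume "rat_cong p r x y" "y \<in> p_integral p"
  then obtain z where "z \<in> p_integral p" "x = of_nat p ^ r * z + y"
    unfolding rat_cong_def by (auto simp: algebra_simps)
  then show ?thesis using \<open>y \<in> _\<close> by (auto intro: p_integral_intros)
qed

lemma p_integral_iff_dvd:
  assumes "of_int a / of_int b \<in> p_integral p" "b \<noteq> 0" "int p dvd b" shows "int p dvd a"
proof -
  from assms(1) obtain c d where cd: "of_int a / of_int b = (of_int c / of_int d :: rat)" "\<not> int p dvd d"
    unfolding p_integral_def by blast
  then have "d \<noteq> 0" by auto
  with cd assms(2) have "of_int (a * d) = (of_int (c * b) :: rat)" by (simp add: field_simps)
  then have "a * d = c * b" by (simp only: of_int_eq_iff)
  then have "int p dvd a * d" using assms(3) by simp
  then show ?thesis using cd(2) p prime_dvd_mult_iff[of "int p"] by auto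
qed

text \<open>If the numerator of \<open>x\<close> were divisible by \<open>p\<close>, then so would be \<open>u\<close>, and \<open>1 / p\<close> would be \<open>p\<close>-integral.\<close>

lemma p_unit_cong:
  assumes "rat_cong p 1 x u" "p_unit p u" shows "p_unit p x"
proof -
  have "x \<in> p_integral p" using p_integral_cong assms p_unit_integral by blast
  then obtain a b where ab: "x = of_int a / of_int b" "\<not> int p dvd b"
    unfolding p_integral_def by blast
  have "\<not> int p dvd a"
  proof
    assume "int p dvd a"
    then obtain c where c: "a = int p * c" by blast
    obtain z where z: "z \<in> p_integral p" "x - u = of_nat p * z"
      using assms(1) unfolding rat_cong_def by auto
    have "x = of_nat p * (of_int c / of_int b)" unfolding ab c by simp
    then have "u = of_nat p * (of_int c / of_int b - z)" using z by (simp add: algebra_simps)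
    moreover have "of_int c / of_int b - z \<in> p_integral p"
      by (intro p_integral_diff p_integral_divide[OF _ p_unit_of_int[OF ab(2)]] p_integral_of_int z(1))
    ultimately obtain s where s: "s \<in> p_integral p" "u = of_nat p * s" by blast
    have "1 = u * inverse u" using p_unit_nonzero[OF assms(2)] by simp
    also have "\<dots> = of_nat p * (s * inverse u)" by (subst s(2)) (simp only: mult.assoc)
    finally have "1 = of_nat p * (s * inverse u)" .
    moreover define v where "v = s * inverse u"
    ultimately have "of_int 1 / of_int (int p) = v"
      using prime_gt_0_nat[OF p] by (simp add: divide_eq_eq mult.commute)
    moreover have "v \<in> p_integral p"
      unfolding v_def using s(1) assms(2) by (rule p_integral_mult[OF _ p_unit_integral[OF p_unit_inverse]])
    ultimately have "int p dvd 1" using p by (intro p_integral_iff_dvd[of 1 "int p"]) auto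
    then show False using p by auto
  qed
  then show ?thesis unfolding ab using ab(2) by (intro p_unit_divide p_unit_of_int)
qed

lemma rat_cong_inverse:
  assumes "rat_cong p r x y" "p_unit p x" "p_unit p y"
  shows "rat_cong p r (inverse x) (inverse y)"
proof (rule rat_cong_cancel[OF p_unit_mult[OF assms(2,3)]])
  have "x * y * inverse x = y" "x * y * inverse y = x"
    using assms(2,3) by (simp_all add: p_unit_nonzero)
  then show "rat_cong p r (x * y * inverse x) (x * y * inverse y)"
    using rat_cong_sym[OF assms(1)] by (simp only:)
qed

lemma rat_cong_divide:
  assumes "rat_cong p r x x'" "rat_cong p r y y'" "x \<in> p_integral p" "p_unit p y" "p_unit p y'"
  shows "rat_cong p r (x / y) (x' / y')"
  unfolding divide_inverse
  by (intro rat_cong_mult rat_cong_inverse p_unit_integral[OF p_unit_inverse] assms)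

lemma rat_congI: "x - y = of_nat p ^ r * z \<Longrightarrow> z \<in> p_integral p \<Longrightarrow> rat_cong p r x y"
  unfolding rat_cong_def by blast

lemma rat_cong_of_int: "[a = b] (mod int p) \<Longrightarrow> rat_cong p 1 (of_int a) (of_int b)"
proof -
  assume "[a = b] (mod int p)"
  then obtain c where "a - b = int p * c" by (auto simp: cong_iff_dvd_diff)
  then have "of_int a - of_int b = (of_nat p * of_int c :: rat)"
    by (metis of_int_diff of_int_mult of_int_of_nat_eq)
  then show ?thesis by (intro rat_congI[of _ _ _ "of_int c"] p_integral_of_int) simp
qed

lemma wilson_rat: "rat_cong p 1 (fact (p - 1)) (-1)"
  using rat_cong_of_int[OF wilson_theorem[OF p]] by simp

lemma fermat_rat: "\<not> p dvd a \<Longrightarrow> rat_cong p 1 (of_nat a ^ (p - 1)) 1"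
  using rat_cong_of_int[OF iffD2[OF cong_int_iff fermat_theorem[OF p, of a]]] by simp

text \<open>Modulo \<open>p\<close>, the factors \<open>p - 1, \<dots>, p - a\<close> of \<open>(p - 1)!\<close> are \<open>- 1, \<dots>, - a\<close>.\<close>

lemma wilson_complement:
  assumes "a + b = p - 1"
  shows "rat_cong p 1 (fact a * fact b) ((-1) ^ (a + 1))"
proof -
  have p1: "of_nat (p - 1) = (of_nat p - 1 :: rat)" using p prime_gt_0_nat[of p] by (simp add: of_nat_diff)
  have ab: "a < p" "b < p" "p - 1 - a = b" "a \<le> p - 1" using assms p prime_gt_0_nat[of p] by auto
  have "rat_cong p 1 (\<Prod>i<a. of_nat i + 1) (\<Prod>i<a. of_nat i - of_nat (p - 1))"
    by (intro rat_cong_prod p_integral_intros rat_congI[where z = 1]) (simp add: p1[simplified])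
  then have "rat_cong p 1 (fact a) ((-1) ^ a * (fact (p - 1) / fact b))"
    unfolding prod_of_nat_plus_1 prod_of_nat_minus[OF ab(4)] ab(3) .
  then have "rat_cong p 1 (fact a * fact b) (((-1) ^ a * (fact (p - 1) / fact b)) * fact b)"
    by (intro rat_cong_mult rat_cong_refl p_integral_intros)
  also have "((-1) ^ a * (fact (p - 1) / fact b)) * fact b = (-1) ^ a * (fact (p - 1) :: rat)" by simp
  finally have "rat_cong p 1 (fact a * fact b) ((-1) ^ a * fact (p - 1))" .
  moreover have "rat_cong p 1 ((-1) ^ a * fact (p - 1)) ((-1) ^ a * (-1))"
    by (intro rat_cong_scale wilson_rat p_integral_intros)
  ultimately show ?thesis using rat_cong_trans[of 1 _ "(-1) ^ a * fact (p - 1)" "(-1) ^ (a + 1)"] by simp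
qed

text \<open>The factors of \<open>(p + b)!\<close> other than \<open>p\<close> are \<open>(p - 1)!\<close>, to which Wilson's theorem applies, and
  \<open>p + 1, \<dots>, p + b\<close>, which reduce to \<open>b!\<close>.\<close>

lemma fact_p_plus:
  obtains X where "fact (p + b) = of_nat p * X" "X \<in> p_integral p" "b < p \<Longrightarrow> rat_cong p 1 X (- fact b)"
proof
  define X where "X = (fact (p - 1) * (\<Prod>i<b. of_nat p + 1 + of_nat i) :: rat)"
  have "fact p = of_nat p * (fact (p - 1) :: rat)" 
    using fact_reduce[OF prime_gt_0_nat[OF p], where ?'a = rat] by simp
  then show "fact (p + b) = of_nat p * X" unfolding X_def fact_add by simp
  show "X \<in> p_integral p" unfolding X_def by (intro p_integral_intros)
  have "rat_cong p 1 (\<Prod>i<b. of_nat p + 1 + of_nat i) (\<Prod>i<b. of_nat i + 1)"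
    by (intro rat_cong_prod p_integral_intros rat_congI[where z = 1]) simp_all
  then have "rat_cong p 1 X ((-1) * (\<Prod>i<b. of_nat i + 1))" unfolding X_def
    by (intro rat_cong_mult[OF wilson_rat] p_integral_intros)
  then show "rat_cong p 1 X (- fact b)" by (simp add: prod_of_nat_plus_1)
qed

text \<open>Here the factors \<open>p\<close> and \<open>2p\<close> are split off, and Wilson's theorem is used twice.\<close>

lemma fact_2p_plus:
  obtains Y where "fact (2 * p + b) = 2 * of_nat p ^ 2 * Y" "Y \<in> p_integral p" "b < p \<Longrightarrow> rat_cong p 1 Y (fact b)"
proof -
  have p0: "p > 0" using p prime_gt_0_nat by blast
  obtain X where X: "fact (p + (p - 1)) = of_nat p * X" "X \<in> p_integral p" "rat_cong p 1 X (- fact (p - 1))"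
    using fact_p_plus[of "p - 1"] p0 by (metis diff_less zero_less_one)
  define Y where "Y = X * (\<Prod>i<b. of_nat (2 * p) + 1 + of_nat i)"
  have e: "p + (p - 1) = 2 * p - 1" using p0 by simp
  have f: "fact (2 * p) = of_nat (2 * p) * (of_nat p * X)"
    unfolding X(1)[symmetric] e by (rule fact_reduce) (use p0 in simp)
  have 1: "fact (2 * p + b) = 2 * of_nat p ^ 2 * Y"
    unfolding Y_def fact_add[of "2 * p"] f by (simp add: power2_eq_square mult_ac)
  have 2: "Y \<in> p_integral p" unfolding Y_def by (intro p_integral_intros X)
  have "rat_cong p 1 X (- (-1))"
    using rat_cong_trans[OF X(3)] rat_cong_scale[OF wilson_rat p_integral_uminus[OF p_integral_1]] by simp
  moreover have "rat_cong p 1 (\<Prod>i<b. of_nat (2 * p) + 1 + of_nat i) (\<Prod>i<b. of_nat i + 1)"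
    by (intro rat_cong_prod p_integral_intros rat_congI[where z = 2]) simp_all
  ultimately have "rat_cong p 1 Y (- (-1) * (\<Prod>i<b. of_nat i + 1))" unfolding Y_def
    by (intro rat_cong_mult X(2) p_integral_intros)
  then have "rat_cong p 1 Y (fact b)" by (simp add: prod_of_nat_plus_1)
  then show thesis using that[OF 1 2] by blast
qed

end

section \<open>Evaluation for primes of the form 6m + 1\<close>

context
  fixes p m :: nat
  assumes p: "prime p" and pm: "p = 6 * m + 1"
begin

lemma m_pos: "m > 0" using p pm by (cases m) auto

lemma P_eq: "(of_nat p :: rat) = 6 * of_nat m + 1" using pm by simp

lemma unit_small: "0 < n \<Longrightarrow> n < p \<Longrightarrow> p_unit p (of_nat n)"
  by (intro p_unit_of_nat[OF p]) (auto dest: dvd_imp_le)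

lemma unit_fact: "j \<le> 6 * m \<Longrightarrow> p_unit p (fact j)"
  by (rule p_unit_fact[OF p]) (simp add: pm)

lemma unit_numeral: "p_unit p 2" "p_unit p 3"
  using unit_small[of 2] unit_small[of 3] m_pos pm by auto

lemma unit_6: "p_unit p 6" and unit_8: "p_unit p 8" and unit_16: "p_unit p 16" and unit_18: "p_unit p 18" and unit_36: "p_unit p 36"
proof -
  show "p_unit p 6" using p_unit_mult[OF p unit_numeral(1) unit_numeral(2)] by simp
  then show "p_unit p 18" "p_unit p 36" using p_unit_mult[OF p _ unit_numeral(2), of 6] p_unit_power[OF p, of 6 2] by simp_all
  show "p_unit p 8" "p_unit p 16"
    using p_unit_power[OF p unit_numeral(1), of 3] p_unit_power[OF p unit_numeral(1), of 4] by simp_all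
qed

lemma unit_3k2: "\<not> p dvd 3 * k + 2 \<Longrightarrow> p_unit p (3 * of_nat k + 2)"
  using p_unit_of_nat[OF p, of "3 * k + 2"] by (simp add: add.commute)

text \<open>As \<open>3k + 2 < 3p\<close> and \<open>p\<close> is not congruent to \<open>2\<close> modulo \<open>3\<close>, the only multiple of \<open>p\<close> among these numbers is
  \<open>2p = 3 (4m) + 2\<close>.\<close>

lemma unit_3k2_small: assumes "k < 6 * m + 1" "k \<noteq> 4 * m" shows "p_unit p (3 * of_nat k + 2)"
proof (rule unit_3k2, rule notI)
  assume "p dvd 3 * k + 2"
  then obtain c where c: "3 * k + 2 = p * c" by blast
  have "p * c < p * 3" unfolding c[symmetric] using assms pm by simp
  then have "c < 3" by simp
  then have "c = 0 \<or> c = 1 \<or> c = 2" by auto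
  then show False using c pm assms by (elim disjE) (simp_all, presburger)
qed

lemma half: "1 / 2 \<in> p_integral p"
  by (rule p_integral_divide[OF p p_integral_1[OF p] unit_numeral(1)])

lemma pf_coeff_integral:
  assumes "t \<in> p_integral p" "k \<le> 3 * m" shows "pf_coeff t (3 * m) k \<in> p_integral p"
  unfolding pf_coeff_def using assms pm
  by (intro p_integral_intros[OF p] p_unit_mult[OF p] p_unit_fact[OF p] half unit_numeral) auto

text \<open>Both sides start with the same value at \<open>k = 0\<close>, and by \<open>ratio_identity_pos\<close> and \<open>ratio_identity_neg\<close> their
  consecutive quotients agree modulo \<open>p\<^sup>2\<close>. The shift
  \<open>t = (p - q) / 2\<close> is what makes the first-order terms agree.\<close>

lemma tele_poly_cong:
  fixes \<epsilon> :: rat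
  assumes \<epsilon>: "\<epsilon> = 1 \<or> \<epsilon> = -1" and "k \<le> 3 * m"
  defines "t \<equiv> (1 - \<epsilon>) / 2 * of_nat p" and "q \<equiv> \<epsilon> * of_nat p"
  shows "rat_cong p 2 (pf_coeff t (3 * m) 0 * tele_poly q k) (pf_coeff t (3 * m) k)"
  using \<open>k \<le> 3 * m\<close>
proof (induction k)
  case 0
  show ?case by (simp add: rat_cong_refl[OF p])
next
  case (Suc k)
  define K where "K = (of_nat (Suc k) :: rat)"
  define P where "P = (of_nat p :: rat)"
  have tI: "t \<in> p_integral p" using \<epsilon> unfolding t_def by (auto intro: p_integral_intros[OF p])
  have qI: "q \<in> p_integral p" using \<epsilon> unfolding q_def by (auto intro: p_integral_intros[OF p])
  have KI: "K \<in> p_integral p" "P \<in> p_integral p" unfolding K_def P_def by (intro p_integral_intros[OF p])+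
  have Ku: "p_unit p K" unfolding K_def using Suc.prems pm by (intro unit_small) auto
  have K0: "K \<noteq> 0" using Ku p_unit_nonzero[OF p] by blast
  have qKu: "p_unit p (q - 2 * K)"
  proof (rule p_unit_cong[OF p])
    show "p_unit p (- (2 * K))" by (intro p_unit_uminus p_unit_mult unit_numeral Ku p)
    show "rat_cong p 1 (q - 2 * K) (- (2 * K))"
      using \<epsilon> by (intro rat_congI[OF p, where z = \<epsilon>]) (auto simp: q_def intro: p_integral_intros[OF p])
  qed
  have qK0: "q - 2 * K \<noteq> 0" using qKu p_unit_nonzero[OF p] by blast
  define \<sigma> where "\<sigma> = (2 * K - 1 + P - q) * (P - 2 * K + 1) / (2 * K * (q - 2 * K))"
  define \<rho> where "\<rho> = (2 * K - 1) / (8 * K ^ 4) * (q + K) * (q - 2 * K + 1) * (q - 2 * K)"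
  have n: "of_nat (3 * m) = (P - 1) / 2" and k: "of_nat k = K - 1"
    unfolding P_def P_eq K_def by simp_all
  have t: "t = (P - q) / 2" unfolding t_def q_def P_def by (simp add: field_simps)
  have "K * ((q - 2 * K) / 2) * pf_coeff t (3 * m) (Suc k)
      = ((2 * K - 1 + P - q) / 2) * ((P - 2 * K + 1) / 2) * pf_coeff t (3 * m) k"
  proof -
    have e: "of_nat k + 1 = K" "of_nat (3 * m) - of_nat k - 1 / 2 - t = (q - 2 * K) / 2"
      "of_nat k + 1 / 2 + t = (2 * K - 1 + P - q) / 2"
      "of_nat (3 * m) - of_nat k = (P - 2 * K + 1) / 2"
      unfolding n k t by (simp_all add: field_simps)
    show ?thesis using pf_coeff_Suc[of k "3 * m" t] Suc.prems unfolding e(1,2,3) unfolding e(4) by simp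
  qed
  then have ws: "pf_coeff t (3 * m) (Suc k) = \<sigma> * pf_coeff t (3 * m) k"
    unfolding \<sigma>_def using K0 qK0 by (simp add: field_simps)
  have us: "tele_poly q (Suc k) = \<rho> * tele_poly q k"
  proof -
    have "step_coeff k * (q + of_nat k + 1) * (q - 2 * of_nat k - 1) * (q - 2 * of_nat k - 2) = \<rho>"
      unfolding step_coeff_def \<rho>_def k by (simp add: algebra_simps)
    then show ?thesis by (simp add: mult.commute)
  qed
  have rI: "\<rho> \<in> p_integral p" unfolding \<rho>_def
    by (intro p_integral_intros[OF p] p_unit_mult[OF p] p_unit_power[OF p] Ku unit_8 KI qI)
  have wI: "pf_coeff t (3 * m) k \<in> p_integral p" using pf_coeff_integral[OF tI] Suc.prems by simp
  have "rat_cong p 2 \<rho> \<sigma>"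
    using \<epsilon>
  proof
    assume "\<epsilon> = 1"
    then have q: "q = P" unfolding q_def P_def by simp
    show ?thesis
    proof (rule rat_congI[OF p])
      show "\<rho> - \<sigma> = of_nat p ^ 2 * ((2 * K - 1) * (P - 2 * K + 1) * (P - 3 * K) / (8 * K ^ 4 * (P - 2 * K)))"
        using ratio_identity_pos[OF K0 qK0[unfolded q]] unfolding \<rho>_def \<sigma>_def q P_def[symmetric] by simp
      show "(2 * K - 1) * (P - 2 * K + 1) * (P - 3 * K) / (8 * K ^ 4 * (P - 2 * K)) \<in> p_integral p"
        by (intro p_integral_intros[OF p] p_unit_mult[OF p] p_unit_power[OF p] Ku unit_8 KI qKu[unfolded q])
    qed
  next
    assume "\<epsilon> = -1"
    then have q: "q = - P" unfolding q_def P_def by simp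
    have d: "2 * K - 1 + P - - P = 2 * K - 1 + 2 * P" by simp
    show ?thesis
    proof (rule rat_congI[OF p])
      show "\<rho> - \<sigma> = of_nat p ^ 2 * (((2 * K - 1) * (2 * K - 1 + P) * (3 * K + P) - 8 * K ^ 3) / (8 * K ^ 4 * (- P - 2 * K)))"
        using ratio_identity_neg[OF K0 qK0[unfolded q]] unfolding \<rho>_def \<sigma>_def q d P_def[symmetric] by simp
      show "((2 * K - 1) * (2 * K - 1 + P) * (3 * K + P) - 8 * K ^ 3) / (8 * K ^ 4 * (- P - 2 * K)) \<in> p_integral p"
        by (intro p_integral_intros[OF p] p_unit_mult[OF p] p_unit_power[OF p] Ku unit_8 KI qKu[unfolded q])
    qed
  qed
  then have "rat_cong p 2 (\<rho> * (pf_coeff t (3 * m) 0 * tele_poly q k)) (\<sigma> * pf_coeff t (3 * m) k)"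
    using Suc.prems by (intro rat_cong_mult[OF p] Suc.IH rI wI) auto
  then show ?case unfolding us ws by (simp add: mult_ac)
qed

abbreviation "sg \<equiv> ((-1) ^ m :: rat)"

lemma sg_sq: "sg * sg = 1" by (simp add: power_mult_distrib[symmetric])

lemma sg_unit: "p_unit p sg" by (intro p_unit_intros[OF p])

text \<open>Wilson's theorem for the complementary pairs \<open>3m + 3m\<close> and \<open>2m + 4m\<close> of \<open>p - 1 = 6m\<close>, and \<open>6m = - 1\<close> modulo \<open>p\<close>.
  These three reductions bring all constants below to a normal form in \<open>(m - 1)!\<close> and \<open>(2m)!\<close>.\<close>

lemma factorial_congs:
  shows "rat_cong p 1 (1 / (fact (3 * m) * fact (3 * m))) (- sg)"
    and "rat_cong p 1 (1 / fact (4 * m)) (- fact (2 * m))"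
    and "rat_cong p 1 (of_nat m * of_nat m) (1 / 36)"
proof -
  have 3: "p_unit p (fact (3 * m) * fact (3 * m))" and 4: "p_unit p (fact (4 * m))"
    by (intro p_unit_mult[OF p] unit_fact; simp)+
  have "(-1) ^ (3 * m + 1) = - sg" by (simp add: power_mult)
  then have "rat_cong p 1 (fact (3 * m) * fact (3 * m)) (- sg)"
    using wilson_complement[OF p, of "3 * m" "3 * m"] pm by simp
  then have "rat_cong p 1 (inverse (fact (3 * m) * fact (3 * m))) (inverse (- sg))"
    by (intro rat_cong_inverse[OF p] 3 p_unit_uminus[OF p] sg_unit)
  moreover have "inverse (- sg) = - sg" by (cases "even m") auto
  ultimately show "rat_cong p 1 (1 / (fact (3 * m) * fact (3 * m))) (- sg)"
    by (simp add: inverse_eq_divide)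
  have "rat_cong p 1 (fact (2 * m) * fact (4 * m)) (- 1)"
    using wilson_complement[OF p, of "2 * m" "4 * m"] pm by simp
  from rat_cong_scale[OF p rat_cong_sym[OF p this] p_integral_uminus[OF p p_integral_1[OF p]]]
  have "rat_cong p 1 1 (fact (4 * m) * (- fact (2 * m)))" by (simp add: mult.commute)
  then have "rat_cong p 1 (fact (4 * m) * (1 / fact (4 * m))) (fact (4 * m) * (- fact (2 * m)))" by simp
  then show "rat_cong p 1 (1 / fact (4 * m)) (- fact (2 * m))" by (rule rat_cong_cancel[OF p 4])
  show "rat_cong p 1 (of_nat m * of_nat m) (1 / 36)"
  proof (rule rat_congI[OF p])
    show "of_nat m * of_nat m - 1 / 36 = of_nat p ^ 1 * ((6 * of_nat m - 1) / (36 :: rat))"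
      unfolding P_eq by (simp add: field_simps)
    show "(6 * of_nat m - 1) / 36 \<in> p_integral p"
      by (intro p_integral_intros[OF p] unit_36)
  qed
qed

abbreviation "fact_pred_m \<equiv> (fact (m - 1) :: rat)"
abbreviation "fact_2m \<equiv> (fact (2 * m) :: rat)"
abbreviation "binom_3m \<equiv> (of_nat ((3 * m) choose m) :: rat)"

lemma fact_m: "fact m = of_nat m * fact_pred_m"
  using m_pos by (rule fact_reduce)

lemma binom_3m_unit: "p_unit p binom_3m"
proof -
  have "binom_3m = fact (3 * m) / (fact m * fact (2 * m))" by (simp add: binomial_fact)
  moreover have "p_unit p (fact (3 * m) / (fact m * fact (2 * m)))"
    by (intro p_unit_divide[OF p] p_unit_mult[OF p] unit_fact) simp_all
  ultimately show ?thesis by simp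
qed

lemma inverse_binom_3m_sq: "rat_cong p 1 (1 / binom_3m\<^sup>2) (- sg * fact_pred_m\<^sup>2 * fact_2m\<^sup>2 / 36)"
proof -
  have "binom_3m = fact (3 * m) / (fact m * fact (2 * m))" by (simp add: binomial_fact)
  then have e: "1 / binom_3m\<^sup>2 = (fact_pred_m\<^sup>2 * fact_2m\<^sup>2) * ((of_nat m * of_nat m) * (1 / (fact (3 * m) * fact (3 * m))))"
    unfolding fact_m by (simp add: power2_eq_square)
  have "rat_cong p 1 (1 / binom_3m\<^sup>2) ((fact_pred_m\<^sup>2 * fact_2m\<^sup>2) * (1 / 36 * (- sg)))"
    unfolding e by (intro rat_cong_scale[OF p] rat_cong_mult[OF p] factorial_congs p_integral_intros[OF p])
  then show ?thesis by (simp add: mult_ac)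
qed

text \<open>The shifted factorial \<open>(1/2) (3/2) \<dots> (m - 1/2)\<close> in the duplication formula for \<open>(2m)!\<close> becomes, modulo \<open>p\<close>, a product
  of consecutive integers, since \<open>1/2 = - 3m\<close>. Hence \<open>(2m)!\<^sup>2 = (-1)^m 4^m m! (3m)!\<close> modulo \<open>p\<close>, and squaring
  removes \<open>(3m)!\<close> by Wilson's theorem.\<close>

lemma duplication: "rat_cong p 1 (fact (2 * m) ^ 4) (- sg * 16 ^ m * fact_pred_m\<^sup>2 / 36)"
proof -
  have c: "rat_cong p 1 (fact (3 * m) * fact (3 * m)) (- sg)"
    using wilson_complement[OF p, of "3 * m" "3 * m"] pm by (simp add: power_mult)
  have "rat_cong p 1 (\<Prod>i<m. 1 / 2 + of_nat i) (\<Prod>i<m. of_nat i - of_nat (3 * m))"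
    by (intro rat_cong_prod[OF p] p_integral_intros[OF p] half rat_congI[OF p, where z = "1 / 2"])
      (simp_all add: P_eq field_simps)
  then have "rat_cong p 1 (\<Prod>i<m. 1 / 2 + of_nat i) (sg * (fact (3 * m) / fact_2m))"
    using prod_of_nat_minus[of m "3 * m"] by simp
  then have "rat_cong p 1 (fact_2m * (4 ^ m * fact m) * (\<Prod>i<m. 1 / 2 + of_nat i))
      (fact_2m * (4 ^ m * fact m) * (sg * (fact (3 * m) / fact_2m)))"
    by (intro rat_cong_scale[OF p] p_integral_intros[OF p])
  moreover have "fact_2m * (4 ^ m * fact m) * (\<Prod>i<m. 1 / 2 + of_nat i) = fact_2m\<^sup>2"
    using fact_double[of m] by (simp add: power2_eq_square mult_ac)
  moreover have "fact_2m * (4 ^ m * fact m) * (sg * (fact (3 * m) / fact_2m)) = 4 ^ m * fact m * (sg * fact (3 * m))"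
    by simp
  ultimately have "rat_cong p 1 (fact_2m\<^sup>2) (4 ^ m * fact m * (sg * fact (3 * m)))" by (simp only:)
  then have "rat_cong p 1 ((fact_2m\<^sup>2)\<^sup>2) ((4 ^ m * fact m * (sg * fact (3 * m)))\<^sup>2)"
    by (intro rat_cong_power[OF p] p_integral_intros[OF p])
  also have "(4 ^ m * fact m * (sg * fact (3 * m)))\<^sup>2
      = (16 ^ m * fact_pred_m\<^sup>2) * ((of_nat m * of_nat m) * (fact (3 * m) * fact (3 * m)))"
    unfolding fact_m power2_eq_square
    using sg_sq power_mult_distrib[of "4 :: rat" 4 m] by (simp add: mult_ac)
  also have "(fact_2m\<^sup>2)\<^sup>2 = fact_2m ^ 4" by simp
  finally have "rat_cong p 1 (fact_2m ^ 4) ((16 ^ m * fact_pred_m\<^sup>2) * ((of_nat m * of_nat m) * (fact (3 * m) * fact (3 * m))))" .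
  moreover have "rat_cong p 1 ((16 ^ m * fact_pred_m\<^sup>2) * ((of_nat m * of_nat m) * (fact (3 * m) * fact (3 * m))))
      ((16 ^ m * fact_pred_m\<^sup>2) * (1 / 36 * (- sg)))"
    by (intro rat_cong_scale[OF p] rat_cong_mult[OF p] c factorial_congs(3) p_integral_intros[OF p])
  ultimately show ?thesis using rat_cong_trans[OF p] by (fastforce simp: mult_ac)
qed

lemma pow_16: "rat_cong p 1 (16 ^ (4 * m)) (16 ^ m)"
proof -
  have "\<not> p dvd 2" using m_pos pm by (auto dest: dvd_imp_le)
  then have "rat_cong p 1 (2 ^ (6 * m)) 1" using fermat_rat[OF p, of 2] pm by simp
  then have "rat_cong p 1 ((2 ^ (6 * m)) ^ 2) (1 ^ 2)"
    by (intro rat_cong_power[OF p] p_integral_intros[OF p])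
  then have "rat_cong p 1 (16 ^ m * (2 ^ (6 * m)) ^ 2) (16 ^ m * 1 ^ 2)"
    by (intro rat_cong_scale[OF p] p_integral_intros[OF p])
  moreover have "(16 :: rat) ^ (4 * m) = 16 ^ m * (2 ^ (6 * m)) ^ 2"
  proof -
    have "(16 :: rat) ^ j = 2 ^ (4 * j)" for j by (simp add: power_mult)
    then show ?thesis by (simp add: power_mult[symmetric] power_add[symmetric])
  qed
  ultimately show ?thesis by simp
qed

text \<open>By \<open>tele_poly_cong\<close> the sum is, up to the unit \<open>w0\<close>, one third of the sum of \<open>pf_coeff t (3m) k / (2/3 + k)\<close>, hence
  a value of the decomposed rational function at \<open>2/3\<close>. The numerator factor with index \<open>m - 1\<close> is \<open>p (3\<epsilon> - 2) / 6\<close>;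
  since it carries a factor \<open>p\<close>, all other factors are needed only modulo \<open>p\<close>, where they are consecutive
  integers.\<close>

lemma head_sum_cong:
  fixes \<epsilon> :: rat
  assumes \<epsilon>: "\<epsilon> = 1 \<or> \<epsilon> = -1"
  shows "rat_cong p 2 (\<Sum>k\<le>3 * m. tele_poly (\<epsilon> * of_nat p) k / (3 * of_nat k + 2))
    (2 * of_nat p * (3 * \<epsilon> - 2) / binom_3m\<^sup>2)"
proof -
  define P where "P = (of_nat p :: rat)"
  define t where "t = (1 - \<epsilon>) / 2 * P"
  define e where "e = 3 * \<epsilon> - 2"
  define w0 where "w0 = pf_coeff t (3 * m) 0"
  define Z where "Z = (\<Sum>k\<le>3 * m. tele_poly (\<epsilon> * P) k / (3 * of_nat k + 2))"
  define d where "d = (fact (4 * m) :: rat)"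
  have \<epsilon>I: "\<epsilon> \<in> p_integral p" using \<epsilon> by (auto intro: p_integral_intros[OF p])
  have eI: "e \<in> p_integral p" unfolding e_def by (intro p_integral_intros[OF p] \<epsilon>I)
  have tI: "t \<in> p_integral p" using \<epsilon> unfolding t_def P_def by (auto intro: p_integral_intros[OF p])
  have P: "P = 6 * of_nat m + 1" unfolding P_def by (rule P_eq)
  have m1: "of_nat (m - 1) = (of_nat m - 1 :: rat)" using m_pos by (simp add: of_nat_diff)
  have du: "p_unit p d" and Au: "p_unit p fact_pred_m" and c3u: "p_unit p (fact (3 * m))"
    unfolding d_def by (intro unit_fact; simp)+
  \<comment> \<open>The difference of corresponding factors is \<open>\<epsilon> p / 2\<close>, because \<open>1/2 + 3m = p/2\<close>.\<close>
  have w0: "rat_cong p 1 w0 sg"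
  proof -
    have "rat_cong p 1 (\<Prod>i<3 * m. - of_nat 0 - (t - 1 / 2 - of_nat i)) (\<Prod>i<3 * m. of_nat i - of_nat (3 * m))"
    proof (intro rat_cong_prod[OF p] p_integral_intros[OF p] tI unit_numeral)
      fix i show "rat_cong p 1 (- of_nat 0 - (t - 1 / 2 - of_nat i)) (of_nat i - of_nat (3 * m))"
        by (rule rat_congI[OF p, where z = "\<epsilon> / 2"])
          (auto simp: t_def P_def[symmetric] P field_simps intro: p_integral_intros[OF p] \<epsilon>I unit_numeral)
    qed
    then have "rat_cong p 1 (\<Prod>i<3 * m. - of_nat 0 - (t - 1 / 2 - of_nat i)) (sg * fact (3 * m))"
      using prod_of_nat_minus[of "3 * m" "3 * m"] by (simp add: power_mult)
    then have "rat_cong p 1 ((\<Prod>i<3 * m. - of_nat 0 - (t - 1 / 2 - of_nat i)) / fact (3 * m)) (sg * fact (3 * m) / fact (3 * m))"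
      by (intro rat_cong_divide[OF p] rat_cong_refl[OF p] c3u p_integral_intros[OF p] tI half)
    then show ?thesis unfolding w0_def pf_coeff_def by simp
  qed
  then have w0u: "p_unit p w0" by (rule p_unit_cong[OF p _ sg_unit])
  \<comment> \<open>\<open>f i\<close> runs over the numerator factors at \<open>2/3\<close>, with the factor of index \<open>m - 1\<close> left out of \<open>X\<close>; \<open>Y\<close> is
    the denominator.\<close>
  define f where "f i = 2 / 3 - (t - 1 / 2 - of_nat i)" for i
  define X where "X = (\<Prod>i<m - 1. f i) * (\<Prod>i<2 * m. f (m - 1 + 1 + i))"
  define Y where "Y = (\<Prod>j<3 * m + 1. 2 / 3 + of_nat j :: rat)"
  have fm: "f (m - 1) = P * e / 6" unfolding f_def m1 t_def e_def P by (simp add: field_simps)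
  have fI: "f i \<in> p_integral p" for i
    unfolding f_def by (intro p_integral_intros[OF p] tI half unit_numeral)
  have XI: "X \<in> p_integral p" unfolding X_def by (intro p_integral_intros[OF p] fI)
  have Xc: "rat_cong p 1 X (- sg * fact_pred_m * fact_2m)"
  proof -
    have f1: "rat_cong p 1 (f i) (of_nat i - of_nat (m - 1))" for i
    proof (rule rat_congI[OF p, where z = "e / 6"])
      have "f i - (of_nat i - of_nat (m - 1)) = f (m - 1)" unfolding f_def by simp
      then show "f i - (of_nat i - of_nat (m - 1)) = of_nat p ^ 1 * (e / 6)"
        unfolding fm P_def by simp
    qed (intro p_integral_intros[OF p] eI unit_6)
    have "rat_cong p 1 (\<Prod>i<m - 1. f i) (\<Prod>i<m - 1. of_nat i - of_nat (m - 1))"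
      by (intro rat_cong_prod[OF p] f1 fI p_integral_intros[OF p])
    moreover have "rat_cong p 1 (\<Prod>i<2 * m. f (m - 1 + 1 + i)) (\<Prod>i<2 * m. of_nat i + 1)"
    proof (intro rat_cong_prod[OF p] fI p_integral_intros[OF p])
      fix i show "rat_cong p 1 (f (m - 1 + 1 + i)) (of_nat i + 1)"
        using f1[of "m - 1 + 1 + i"] by (simp add: add.commute)
    qed
    ultimately have "rat_cong p 1 X ((\<Prod>i<m - 1. of_nat i - of_nat (m - 1)) * (\<Prod>i<2 * m. of_nat i + 1))"
      unfolding X_def by (intro rat_cong_mult[OF p] fI p_integral_intros[OF p])
    moreover have "(-1) ^ (m - 1) = - sg" using m_pos by (cases m) auto
    ultimately show ?thesis using prod_of_nat_minus[of "m - 1" "m - 1"] by (simp add: prod_of_nat_plus_1)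
  qed
  have Yc: "rat_cong p 1 Y (- sg * (d / fact_pred_m))"
  proof -
    have "rat_cong p 1 Y (\<Prod>j<3 * m + 1. of_nat j - of_nat (4 * m))" unfolding Y_def
    proof (intro rat_cong_prod[OF p] p_integral_intros[OF p] unit_numeral)
      fix j show "rat_cong p 1 (2 / 3 + of_nat j) (of_nat j - of_nat (4 * m))"
        by (rule rat_congI[OF p, where z = "2 / 3"])
          \<comment> \<open>\<open>2/3 + 4m = 2p/3\<close>\<close>
          (auto simp: P_eq field_simps intro: p_integral_intros[OF p] unit_numeral)
    qed
    moreover have "4 * m - (3 * m + 1) = m - 1" "3 * m + 1 \<le> 4 * m" using m_pos by auto
    ultimately show ?thesis
      using prod_of_nat_minus[of "3 * m + 1" "4 * m"] unfolding d_def by (simp add: power_mult)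
  qed
  have Yu: "p_unit p Y" by (rule p_unit_cong[OF p Yc]) (intro p_unit_intros(2-5)[OF p] sg_unit du Au)
  have "(\<Sum>k\<le>3 * m. pf_coeff t (3 * m) k / (2 / 3 + of_nat k)) = (\<Prod>i<3 * m. f i) / (\<Prod>j\<le>3 * m. 2 / 3 + of_nat j)"
    unfolding pf_coeff_def f_def
  proof (rule partial_fraction_linear_factors)
    fix j show "(2 / 3 + of_nat j :: rat) \<noteq> 0" using three_k_2_neq_0[of j] by simp
  qed
  moreover have "(\<Prod>j\<le>3 * m. 2 / 3 + of_nat j) = Y" unfolding Y_def by (simp add: lessThan_Suc_atMost)
  moreover have "(\<Prod>i<3 * m. f i) = (P * e / 6) * X"
  proof -
    have "3 * m = m - 1 + 1 + 2 * m" using m_pos by simp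
    then show ?thesis using prod_shift_one[of f "m - 1" "2 * m"] unfolding X_def fm by (simp add: mult_ac)
  qed
  ultimately have pf: "(\<Sum>k\<le>3 * m. pf_coeff t (3 * m) k / (2 / 3 + of_nat k)) = P * e / 6 * X / Y" by simp
  have "rat_cong p 2 (w0 * Z) (\<Sum>k\<le>3 * m. 1 / (3 * of_nat k + 2) * pf_coeff t (3 * m) k)"
  proof -
    have "rat_cong p 2 (\<Sum>k\<le>3 * m. 1 / (3 * of_nat k + 2) * (w0 * tele_poly (\<epsilon> * P) k))
        (\<Sum>k\<le>3 * m. 1 / (3 * of_nat k + 2) * pf_coeff t (3 * m) k)"
      unfolding w0_def t_def P_def
      by (intro rat_cong_sum[OF p] rat_cong_scale[OF p] tele_poly_cong[OF \<epsilon>] p_integral_divide[OF p]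
          p_integral_1[OF p] unit_3k2_small) (use m_pos in auto)
    then show ?thesis unfolding Z_def sum_distrib_left by (simp add: mult_ac)
  qed
  also have "(\<Sum>k\<le>3 * m. 1 / (3 * of_nat k + 2) * pf_coeff t (3 * m) k)
      = (\<Sum>k\<le>3 * m. 1 / 3 * (pf_coeff t (3 * m) k / (2 / 3 + of_nat k)))"
    by (intro sum.cong refl) (use three_k_2_neq_0 in \<open>simp add: divide_simps\<close>)
  also have "\<dots> = of_nat p ^ 1 * (e * (X / (18 * Y)))"
    unfolding sum_distrib_left[symmetric] pf P_def by simp
  finally have "rat_cong p 2 (w0 * Z) (of_nat p ^ 1 * (e * (X / (18 * Y))))" .
  moreover have "rat_cong p 2 (of_nat p ^ 1 * (e * (X / (18 * Y)))) (of_nat p ^ 1 * (e * (2 * w0 * (1 / binom_3m\<^sup>2))))"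
  proof (rule rat_cong_p_mult[OF p rat_cong_scale[OF p _ eI]])
    have "rat_cong p 1 (X / (18 * Y)) (- sg * fact_pred_m * fact_2m / (18 * (- sg * (d / fact_pred_m))))"
      by (intro rat_cong_divide[OF p] Xc XI rat_cong_scale[OF p] Yc unit_18 Yu p_integral_numeral[OF p]
          p_unit_intros(2-5)[OF p] sg_unit du Au)
    also have "- sg * fact_pred_m * fact_2m / (18 * (- sg * (d / fact_pred_m))) = fact_pred_m\<^sup>2 * fact_2m / 18 * (1 / d)"
      by (simp add: power2_eq_square)
    finally have 1: "rat_cong p 1 (X / (18 * Y)) (fact_pred_m\<^sup>2 * fact_2m / 18 * (1 / d))" .
    have 2: "rat_cong p 1 (fact_pred_m\<^sup>2 * fact_2m / 18 * (1 / d)) (fact_pred_m\<^sup>2 * fact_2m / 18 * (- fact_2m))"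
      unfolding d_def by (intro rat_cong_scale[OF p] factorial_congs p_integral_intros[OF p] unit_18)
    have 3: "rat_cong p 1 (2 * w0 * (1 / binom_3m\<^sup>2)) (2 * sg * (- sg * fact_pred_m\<^sup>2 * fact_2m\<^sup>2 / 36))"
      by (intro rat_cong_mult[OF p] rat_cong_scale[OF p] w0 inverse_binom_3m_sq p_integral_intros[OF p] unit_36
          p_unit_integral[OF p w0u])
    have 4: "2 * sg * (- sg * fact_pred_m\<^sup>2 * fact_2m\<^sup>2 / 36) = fact_pred_m\<^sup>2 * fact_2m / 18 * (- fact_2m)"
      using sg_sq by (simp add: power2_eq_square)
    show "rat_cong p 1 (X / (18 * Y)) (2 * w0 * (1 / binom_3m\<^sup>2))"
      using rat_cong_trans[OF p rat_cong_trans[OF p 1 2]] rat_cong_sym[OF p 3[unfolded 4]] by blast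
  qed simp
  ultimately have "rat_cong p 2 (w0 * Z) (of_nat p ^ 1 * (e * (2 * w0 * (1 / binom_3m\<^sup>2))))"
    by (rule rat_cong_trans[OF p])
  also have "of_nat p ^ 1 * (e * (2 * w0 * (1 / binom_3m\<^sup>2))) = w0 * (2 * of_nat p * e / binom_3m\<^sup>2)" by simp
  finally show ?thesis
    unfolding Z_def P_def e_def by (rule rat_cong_cancel[OF p w0u])
qed

text \<open>By \<open>tele_poly_neg_closed\<close> each term has a factor \<open>p\<close> from \<open>(2k)!\<close> and \<open>p\<^sup>2\<close> from \<open>(p + 2k)!\<close>. The denominator \<open>3k + 2\<close>
  takes one of these away exactly for \<open>k = 4m\<close>.\<close>

lemma tail_sum_cong:
  "rat_cong p 3 (\<Sum>k\<in>{3 * m<..6 * m}. of_nat p * tele_poly (- of_nat p) k / (3 * of_nat k + 2))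
    (9 * of_nat p ^ 2 / binom_3m\<^sup>2)"
proof -
  define h where "h k = (if k = 4 * m then 9 * of_nat p ^ 2 / binom_3m\<^sup>2 else 0)" for k
  have "rat_cong p 3 (of_nat p * tele_poly (- of_nat p) k / (3 * of_nat k + 2)) (h k)"
    if "k \<in> {3 * m<..6 * m}" for k
  proof -
    define b where "b = 2 * k - p"
    have b: "2 * k = p + b" "p + 2 * k = 2 * p + b" using that pm by (auto simp: b_def)
    obtain X where X: "fact (p + b) = of_nat p * X" "X \<in> p_integral p" "b < p \<Longrightarrow> rat_cong p 1 X (- fact b)"
      using fact_p_plus[OF p] by blast
    obtain Y where Y: "fact (2 * p + b) = 2 * of_nat p ^ 2 * Y" "Y \<in> p_integral p" "b < p \<Longrightarrow> rat_cong p 1 Y (fact b)"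
      using fact_2p_plus[OF p] by blast
    define D where "D = (fact k ^ 5 * 16 ^ k * fact (p - 1 - k) :: rat)"
    have Du: "p_unit p D" unfolding D_def using that pm
      by (intro p_unit_mult[OF p] p_unit_power[OF p] unit_fact unit_16) auto
    have D0: "D \<noteq> 0" by (rule p_unit_nonzero[OF p Du])
    have "of_nat p * tele_poly (- of_nat p) k * D = (-1) ^ k * fact (2 * k) * fact (p + 2 * k)"
      using tele_poly_neg_closed[of k p] that pm unfolding D_def by simp
    then have "of_nat p * tele_poly (- of_nat p) k * D = of_nat p ^ 3 * ((-1) ^ k * X * (2 * Y))"
      unfolding b(2) unfolding b(1) X Y by (simp add: power2_eq_square power3_eq_cube mult_ac)
    then have closed: "of_nat p * tele_poly (- of_nat p) k = of_nat p ^ 3 * ((-1) ^ k * X * (2 * Y) / D)"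
      using D0 by (simp add: eq_divide_eq)
    show ?thesis
    proof (cases "k = 4 * m")
      case False
      have "of_nat p * tele_poly (- of_nat p) k / (3 * of_nat k + 2) - h k
          = of_nat p ^ 3 * ((-1) ^ k * X * (2 * Y) / D / (3 * of_nat k + 2))"
        unfolding closed h_def using False by simp
      then show ?thesis
        by (rule rat_congI[OF p]) (use that False in \<open>intro p_integral_intros[OF p] X(2) Y(2) Du unit_3k2_small; simp\<close>)
    next
      case True
      have bm: "b = 2 * m - 1" "p - 1 - k = 2 * m" "b < p" using True m_pos pm unfolding b_def by auto
      define g where "g = (fact b :: rat)"
      define d where "d = (fact (4 * m) :: rat)"
      have P0: "(of_nat p :: rat) \<noteq> 0" using pm by simp
      have k2: "3 * of_nat k + 2 = 2 * (of_nat p :: rat)" unfolding True P_eq by simp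
      have "of_nat p * tele_poly (- of_nat p) k / (3 * of_nat k + 2) = of_nat p ^ 2 * (X * Y / D)"
      proof -
        have "(-1 :: rat) ^ k = 1" unfolding True by (simp add: power_mult)
        then show ?thesis unfolding closed k2 using P0 D0
          by (simp add: field_simps power2_eq_square power3_eq_cube)
      qed
      also have "X * Y / D = X * Y * ((1 / d) ^ 5 * (1 / (16 ^ (4 * m) * fact_2m)))"
        unfolding D_def True bm(2)[unfolded True] d_def by (simp add: power_divide)
      finally have 0: "of_nat p * tele_poly (- of_nat p) k / (3 * of_nat k + 2)
        = of_nat p ^ 2 * (X * Y * ((1 / d) ^ 5 * (1 / (16 ^ (4 * m) * fact_2m))))" .
      have Bu: "p_unit p fact_2m" and du: "p_unit p d" unfolding d_def by (intro unit_fact; simp)+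
      have gI: "g \<in> p_integral p" unfolding g_def by (intro p_integral_intros[OF p])
      have u: "p_unit p (16 ^ (4 * m) * fact_2m)" "p_unit p (16 ^ (4 * m))" "p_unit p (16 ^ m)"
        by (intro p_unit_mult[OF p] p_unit_power[OF p] unit_16 Bu)+
      have "rat_cong p 1 (X * Y * ((1 / d) ^ 5 * (1 / (16 ^ (4 * m) * fact_2m)))) (- g * g * ((- fact_2m) ^ 5 * (1 / (16 ^ (4 * m) * fact_2m))))"
        unfolding g_def d_def
        by (intro rat_cong_mult[OF p] X Y bm rat_cong_power[OF p] factorial_congs rat_cong_refl[OF p] p_integral_intros[OF p]
            u du[unfolded d_def])
      also have "- g * g * ((- fact_2m) ^ 5 * (1 / (16 ^ (4 * m) * fact_2m))) = g * g * fact_2m ^ 4 / 16 ^ (4 * m)"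
        using p_unit_nonzero[OF p Bu] by (simp add: eval_nat_numeral)
      finally have 1: "rat_cong p 1 (X * Y * ((1 / d) ^ 5 * (1 / (16 ^ (4 * m) * fact_2m)))) (g * g * fact_2m ^ 4 / 16 ^ (4 * m))" .
      have "fact_2m = of_nat (2 * m) * g" unfolding g_def bm(1) by (rule fact_reduce) (use m_pos in simp)
      then have "36 * (g * g) * (of_nat m * of_nat m) = 9 * fact_2m\<^sup>2" by (simp add: power2_eq_square)
      moreover have "rat_cong p 1 (36 * (g * g) * (of_nat m * of_nat m)) (36 * (g * g) * (1 / 36))"
        by (intro rat_cong_scale[OF p] factorial_congs p_integral_intros[OF p] gI)
      ultimately have "rat_cong p 1 (9 * fact_2m\<^sup>2) (36 * (g * g) * (1 / 36))" by (simp only:)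
      then have "rat_cong p 1 (9 * fact_2m\<^sup>2) (g * g)" by simp
      then have "rat_cong p 1 (g * g) (9 * fact_2m\<^sup>2)" by (rule rat_cong_sym[OF p])
      then have 2: "rat_cong p 1 (g * g * fact_2m ^ 4 / 16 ^ (4 * m)) (9 * fact_2m\<^sup>2 * (- sg * 16 ^ m * fact_pred_m\<^sup>2 / 36) / 16 ^ m)"
        by (intro rat_cong_divide[OF p rat_cong_mult[OF p _ duplication] pow_16] u p_integral_intros[OF p] gI unit_36)
      have 3: "9 * fact_2m\<^sup>2 * (- sg * 16 ^ m * fact_pred_m\<^sup>2 / 36) / 16 ^ m = 9 * (- sg * fact_pred_m\<^sup>2 * fact_2m\<^sup>2 / 36)"
        by simp
      have 4: "rat_cong p 1 (9 * (1 / binom_3m\<^sup>2)) (9 * (- sg * fact_pred_m\<^sup>2 * fact_2m\<^sup>2 / 36))"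
        by (intro rat_cong_scale[OF p] inverse_binom_3m_sq p_integral_intros[OF p])
      have "rat_cong p 3 (of_nat p ^ 2 * (X * Y * ((1 / d) ^ 5 * (1 / (16 ^ (4 * m) * fact_2m)))))
          (of_nat p ^ 2 * (9 * (1 / binom_3m\<^sup>2)))"
        by (rule rat_cong_p_mult[OF p rat_cong_trans[OF p 1 rat_cong_trans[OF p 2[unfolded 3] rat_cong_sym[OF p 4]]]]) simp
      then show ?thesis unfolding 0 h_def using True by (simp add: mult_ac)
    qed
  qed
  then have "rat_cong p 3 (\<Sum>k\<in>{3 * m<..6 * m}. of_nat p * tele_poly (- of_nat p) k / (3 * of_nat k + 2))
      (\<Sum>k\<in>{3 * m<..6 * m}. h k)" by (rule rat_cong_sum[OF p])
  moreover have "(\<Sum>k\<in>{3 * m<..6 * m}. h k) = 9 * of_nat p ^ 2 / binom_3m\<^sup>2"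
    using m_pos unfolding h_def by simp
  ultimately show ?thesis by simp
qed

lemma Domb_sum_4_cong:
  "rat_cong p 3 (\<Sum>k=0..p-1. (3 * of_nat k + 2) * (of_nat (Domb k) / 4 ^ k)) (2 * of_nat p ^ 2 / binom_3m\<^sup>2)"
proof -
  define P where "P = (of_nat p :: rat)"
  have "tele_poly P k = 0" if "p < 2 * k" for k
    using domb_poly_tele_poly[of P k] domb_poly_of_nat_eq_0[OF that] pm unfolding P_def by simp
  then have "(\<Sum>k\<le>p-1. tele_poly P k / (3 * of_nat k + 2)) = (\<Sum>k\<le>3 * m. tele_poly P k / (3 * of_nat k + 2))"
    using pm by (intro sum.mono_neutral_right) auto
  then have S: "(\<Sum>k=0..p-1. (3 * of_nat k + 2) * (of_nat (Domb k) / 4 ^ k))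
      = P ^ 1 * ((3 * P + 1) * (\<Sum>k\<le>3 * m. tele_poly P k / (3 * of_nat k + 2)))"
    using Domb_sum_4[of p] pm unfolding P_def[symmetric] by simp
  have "rat_cong p 2 (\<Sum>k\<le>3 * m. tele_poly P k / (3 * of_nat k + 2)) (2 * P / binom_3m\<^sup>2)"
    using head_sum_cong[of 1] unfolding P_def by simp
  from rat_cong_p_mult[OF p rat_cong_scale[OF p this, of "3 * P + 1"], of 1 3]
  have 1: "rat_cong p 3 (P ^ 1 * ((3 * P + 1) * (\<Sum>k\<le>3 * m. tele_poly P k / (3 * of_nat k + 2))))
      (P ^ 1 * ((3 * P + 1) * (2 * P / binom_3m\<^sup>2)))"
    unfolding P_def by (simp add: p_integral_intros[OF p])
  have 2: "rat_cong p 3 (P ^ 1 * ((3 * P + 1) * (2 * P / binom_3m\<^sup>2))) (2 * P ^ 2 / binom_3m\<^sup>2)"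
    using p_unit_nonzero[OF p binom_3m_unit]
    by (intro rat_congI[OF p, where z = "6 / binom_3m\<^sup>2"] p_integral_intros[OF p] p_unit_power[OF p] binom_3m_unit)
      (simp add: P_def[symmetric] field_simps eval_nat_numeral)
  show ?thesis unfolding S using rat_cong_trans[OF p 1 2] unfolding P_def .
qed

lemma Domb_sum_16_cong:
  "rat_cong p 3 (2 * (\<Sum>k=0..p-1. (3 * of_nat k + 1) * (of_nat (Domb k) / 16 ^ k))) (2 * of_nat p ^ 2 / binom_3m\<^sup>2)"
proof -
  define P where "P = (of_nat p :: rat)"
  define Z where "Z = (\<Sum>k\<le>3 * m. tele_poly (- P) k / (3 * of_nat k + 2))"
  define T where "T = (\<Sum>k\<in>{3 * m<..6 * m}. P * tele_poly (- P) k / (3 * of_nat k + 2))"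
  have PI: "P \<in> p_integral p" unfolding P_def by (rule p_integral_of_nat[OF p])
  have "{..p - 1} = {..3 * m} \<union> {3 * m<..6 * m}" using pm by auto
  moreover have "{..3 * m} \<inter> {3 * m<..6 * m} = {}" by auto
  ultimately have "P * (\<Sum>k\<le>p-1. tele_poly (- P) k / (3 * of_nat k + 2)) = P ^ 1 * Z + T"
    unfolding Z_def T_def by (simp add: sum.union_disjoint sum_distrib_left distrib_left)
  moreover have "2 * (\<Sum>k=0..p-1. (3 * of_nat k + 1) * (of_nat (Domb k) / 16 ^ k))
      = - 2 * (1 - 3 * P) * (P * (\<Sum>k\<le>p-1. tele_poly (- P) k / (3 * of_nat k + 2)))"
    unfolding Domb_sum_16[OF prime_gt_0_nat[OF p]] P_def[symmetric]
    by (simp only: mult_ac mult_minus_left mult_minus_right)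
  ultimately have S: "2 * (\<Sum>k=0..p-1. (3 * of_nat k + 1) * (of_nat (Domb k) / 16 ^ k))
      = - 2 * (1 - 3 * P) * (P ^ 1 * Z + T)" by simp
  have "rat_cong p 2 Z (- 10 * P / binom_3m\<^sup>2)"
    using head_sum_cong[of "- 1"] unfolding P_def Z_def by simp
  then have "rat_cong p 3 (P ^ 1 * Z) (P ^ 1 * (- 10 * P / binom_3m\<^sup>2))"
    unfolding P_def by (rule rat_cong_p_mult[OF p]) simp
  moreover have "rat_cong p 3 T (9 * P ^ 2 / binom_3m\<^sup>2)" unfolding T_def P_def by (rule tail_sum_cong)
  ultimately have "rat_cong p 3 (- 2 * (1 - 3 * P) * (P ^ 1 * Z + T))
      (- 2 * (1 - 3 * P) * (P ^ 1 * (- 10 * P / binom_3m\<^sup>2) + 9 * P ^ 2 / binom_3m\<^sup>2))"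
    by (intro rat_cong_scale[OF p rat_cong_add[OF p]] p_integral_intros[OF p] PI)
  moreover have "rat_cong p 3 (- 2 * (1 - 3 * P) * (P ^ 1 * (- 10 * P / binom_3m\<^sup>2) + 9 * P ^ 2 / binom_3m\<^sup>2)) (2 * P ^ 2 / binom_3m\<^sup>2)"
    using p_unit_nonzero[OF p binom_3m_unit]
    by (intro rat_congI[OF p, where z = "- 6 / binom_3m\<^sup>2"] p_integral_intros[OF p] p_unit_power[OF p] binom_3m_unit)
      (simp add: P_def[symmetric] field_simps eval_nat_numeral)
  ultimately show ?thesis unfolding S using rat_cong_trans[OF p, of 3] unfolding P_def by blast
qed

end

section \<open>The congruences for the Domb sums\<close>

theorem theorem1p2:
  fixes p :: nat
  assumes "prime p" and "[p = 1] (mod 3)"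
  shows "rat_cong p 3
           (\<Sum>k=0..p-1. (3 * of_nat k + 2) * (of_nat (Domb k) / 4 ^ k))
           (2 * (\<Sum>k=0..p-1. (3 * of_nat k + 1) * (of_nat (Domb k) / 16 ^ k)))
       \<and> rat_cong p 3
           (2 * (\<Sum>k=0..p-1. (3 * of_nat k + 1) * (of_nat (Domb k) / 16 ^ k)))
           (2 * of_nat p ^ 2 * (of_nat (((p - 1) div 2) choose ((p - 1) div 6))) powi (-2))"
proof -
  have "p mod 3 = 1" using assms(2) by (simp add: cong_def)
  moreover from this have "p \<noteq> 2" by auto
  with assms(1) have "odd p" using primes_dvd_imp_eq two_is_prime_nat by blast
  ultimately have "p = 6 * (p div 6) + 1" by presburger
  then obtain m where pm: "p = 6 * m + 1" by blast
  have e: "2 * of_nat p ^ 2 * (of_nat (((p - 1) div 2) choose ((p - 1) div 6))) powi (-2)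
      = 2 * of_nat p ^ 2 / (of_nat ((3 * m) choose m) :: rat)\<^sup>2"
    by (simp add: pm power_int_minus divide_inverse)
  note D4 = Domb_sum_4_cong[OF assms(1) pm] and D16 = Domb_sum_16_cong[OF assms(1) pm]
  show ?thesis unfolding e
    using D16 rat_cong_trans[OF assms(1) D4 rat_cong_sym[OF assms(1) D16]] by blast
qed

end
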